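(* Let $K$ be any Talagrand compactum (that is, the final compactum $K=K_{\omega_1}$ of some realisation of Talagrand's transfinite construction scheme, as described in the context) satisfying Talagrand's conclusion: the Banach space $C(K)$ has the Grothendieck property and the weak-star compact unit ball of $C(K)^*$ contains no copy of $\beta\omega$. Then $C_{\mathrm p}(K)$ has no quotient isomorphic to $(c_0)_{\mathrm p}$, to $(\ell_\infty)_{\mathrm p}$, or to $(\ell_p)_{\mathrm p}$ for any $1\le p<\infty$.
   Context: Function spaces. $C_{\mathrm p}(K)$ is the space of real-valued continuous functions on $K$ with the topology of pointwise convergence. For a Banach sequence space $Y\subseteq\mathbb R^\omega$, $Y_{\mathrm p}$ denotes $Y$ with the topology inherited from the product $\mathbb R^\omega$. A quotient map between locally convex spaces is a continuous open linear surjection onto the target; "$E$ has a quotient isomorphic to $F$" means that there is such a quotient of $E$ linearly homeomorphic to $F$. A Banach space $E$ has the Grothendieck property if every weak-star convergent sequence in $E^*$ is weakly convergent. A "copy of $\beta\omega$" is a subspace (in the weak-star topology) homeomorphic to $\beta\omega$. Talagrand's construction scheme (Talagrand 1980, under CH). It is not a canonical unique object: it depends on enumerations, a scheduling map, and choices at successor stages. One constructs compact spaces $K_\alpha\subseteq 2^\alpha$ ($\omega\le\alpha\le\omega_1$) with bonding maps $\pi_{\beta,\alpha}:K_\alpha\to K_\beta$ the coordinate projections: $K_\omega=2^\omega$; $K_{\alpha+1}=(Y_\alpha\times\{0\})\cup(Z_\alpha\times\{1\})$ with $Y_\alpha,Z_\alpha$ closed and $Y_\alpha\cup Z_\alpha=K_\alpha$;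 at limits $K_\rho$ is the inverse limit of the earlier stages. The scheduling map $\eta$ assigns to each $\alpha<\omega_1$ a pair $(\theta,\delta)$ with $\theta,\delta\le\alpha$, so that every pair in $[\omega,\omega_1)\times\omega_1$ is eventually scheduled. For each $\beta<\omega_1$, $(U_n(\beta,\gamma))_{n\in\omega}$, $\gamma<\omega_1$, enumerate all sequences of pairwise disjoint non-empty clopen subsets of $K_\beta$; if $\eta(\theta)=(\beta,\gamma)$, put $V_n(\theta,\alpha)=\pi_{\beta,\alpha}^{-1}(U_n(\beta,\gamma))$. For each $\theta$, $(\nu_n(\theta,\delta))_{n\in\omega}$, $\delta<\omega_1$, enumerate all sequences of signed measures in $M(K_\theta)$ with $\|\nu_n(\theta,\delta)\|=|\nu_n(\theta,\delta)|(V_n(\theta,\theta))=1$ and $\|\nu_n(\theta,\delta)^+\|\ge 1/2$. Put $B_n(\theta,\delta,\alpha)=\{\lambda\in M(K_\alpha):\|\lambda\|=1,\ (\pi_{\theta,\alpha})_*\lambda=\nu_n(\theta,\delta)\}$. For $\omega\le\theta<\alpha$ and $\delta<\alpha$ there are sets $I(\theta,\alpha),J(\theta,\delta,\alpha),N_0(\theta,\delta),N_1(\theta,\delta)\subseteq\omega$ such that: (A) $J(\theta,\delta,\alpha)\subseteq I(\theta,\alpha)$; (B) $N_0(\theta,\delta)\cap N_1(\theta,\delta)=\varnothing$; (C) $J(\theta,\delta,\alpha)\cap N_e(\theta,\delta)$ is infinite for $e=0,1$; (D) if $\alpha'\le\alpha$ and $\delta<\alpha'$, then $J(\theta,\delta,\alpha)\setminus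 J(\theta,\delta,\alpha')$ and $I(\theta,\alpha)\setminus I(\theta,\alpha')$ are finite whenever both sides are defined; (E) if $\omega\le\theta\le\alpha'<\alpha$, then for all sufficiently large $n\in I(\theta,\alpha)$, whenever $t,t'\in V_n(\theta,\alpha)$ have the same projection to $K_\theta$, $t(\alpha')=t'(\alpha')$; (F) for every choice $\lambda_n\in B_n(\theta,\delta,\alpha)$, the weak-star limit of $\lambda_n$ as $n\to\infty$ along $J(\theta,\delta,\alpha)$ exists; (G) if $\alpha=\alpha'+1$ and $\eta(\alpha')=(\theta,\delta)$, then for every choice $\lambda_n\in B_n(\theta,\delta,\alpha)$ both sets $\{n:\lambda_n(Z_{\alpha'}\times\{1\})\ge 1/6\}$ and $\{n:\lambda_n(Z_{\alpha'}\times\{1\})=0\}$ are infinite. Any such system is a realisation of the scheme. *)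

theory Defs
  imports "HOL-Analysis.Analysis" "HOL-Library.Countable_Set_Type"
begin

section \<open>Linear spaces of real functions\<close>

text \<open>
  All vector spaces below are linear subspaces of some \<open>'a \<Rightarrow> real\<close> with the pointwise operations.
  A space of functions on a proper subset of \<open>'a\<close> is represented by functions vanishing off that
  subset, so that it is literally a linear subspace and equality is equality on the subset.
\<close>

definition linear_map_on :: "('a \<Rightarrow> real) set \<Rightarrow> (('a \<Rightarrow> real) \<Rightarrow> ('b \<Rightarrow> real)) \<Rightarrow> bool" where
  "linear_map_on E T \<longleftrightarrow>
     (\<forall>f\<in>E. \<forall>g\<in>E. T (\<lambda>x. f x + g x) = (\<lambda>y. T f y + T g y)) \<and>
     (\<forall>f\<in>E. \<forall>c. T (\<lambda>x. c * f x) = (\<lambda>y. c * T f y))"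

definition linear_functional_on :: "('a \<Rightarrow> real) set \<Rightarrow> (('a \<Rightarrow> real) \<Rightarrow> real) \<Rightarrow> bool" where
  "linear_functional_on E \<phi> \<longleftrightarrow>
     (\<forall>f\<in>E. \<forall>g\<in>E. \<phi> (\<lambda>x. f x + g x) = \<phi> f + \<phi> g) \<and>
     (\<forall>f\<in>E. \<forall>c. \<phi> (\<lambda>x. c * f x) = c * \<phi> f)"

definition pointwise_topology :: "('a \<Rightarrow> real) set \<Rightarrow> ('a \<Rightarrow> real) topology" where
  "pointwise_topology E = subtopology (powertop_real UNIV) E"

text \<open>
  A locally convex space is given by its topology, the carrier being the \<open>topspace\<close>.
\<close>

definition linear_quotient_map ::
  "('a \<Rightarrow> real) topology \<Rightarrow> ('b \<Rightarrow> real) topology \<Rightarrow> (('a \<Rightarrow> real) \<Rightarrow> ('b \<Rightarrow> real)) \<Rightarrow> bool" where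
  "linear_quotient_map E F q \<longleftrightarrow>
     linear_map_on (topspace E) q \<and> continuous_map E F q \<and> open_map E F q \<and>
     q ` topspace E = topspace F"

text \<open>
  If \<open>q\<close> is a quotient map of \<open>E\<close> onto \<open>G\<close> and \<open>h\<close> is a linear homeomorphism of \<open>G\<close> onto \<open>F\<close>, then
  \<open>h \<circ> q\<close> is a quotient map of \<open>E\<close> onto \<open>F\<close>; so the quotient can be taken to be \<open>F\<close> itself.
\<close>

definition has_quotient_isomorphic :: "('a \<Rightarrow> real) topology \<Rightarrow> ('b \<Rightarrow> real) topology \<Rightarrow> bool" where
  "has_quotient_isomorphic E F \<longleftrightarrow> (\<exists>q. linear_quotient_map E F q)"

definition c_zero :: "(nat \<Rightarrow> real) set" where
  "c_zero = {x. x \<longlonglongrightarrow> 0}"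

definition l_infinity :: "(nat \<Rightarrow> real) set" where
  "l_infinity = {x. bounded (range x)}"

definition l_space :: "real \<Rightarrow> (nat \<Rightarrow> real) set" where
  "l_space p = {x. summable (\<lambda>n. \<bar>x n\<bar> powr p)}"

definition continuous_functions :: "'a topology \<Rightarrow> ('a \<Rightarrow> real) set" where
  "continuous_functions X =
     {f. continuous_map X euclideanreal f \<and> (\<forall>x. x \<notin> topspace X \<longrightarrow> f x = 0)}"

text \<open>
  Members of \<open>continuous_functions X\<close> vanish off \<open>X\<close>, so this is the supremum over \<open>X\<close>.
\<close>

definition sup_norm :: "('a \<Rightarrow> real) \<Rightarrow> real" where
  "sup_norm f = (SUP x. \<bar>f x\<bar>)"


section \<open>Duals, the Grothendieck property, and the Stone-Cech compactification of the integers\<close>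

text \<open>
  For a normed space \<open>E\<close> with norm \<open>N\<close>. Functionals vanish off \<open>E\<close>; the dual is again a linear
  space of real functions, so the construction can be iterated.
\<close>

definition dual_space :: "('a \<Rightarrow> real) set \<Rightarrow> (('a \<Rightarrow> real) \<Rightarrow> real) \<Rightarrow> (('a \<Rightarrow> real) \<Rightarrow> real) set" where
  "dual_space E N =
     {\<phi>. linear_functional_on E \<phi> \<and> (\<exists>C. \<forall>f\<in>E. \<bar>\<phi> f\<bar> \<le> C * N f) \<and> (\<forall>f. f \<notin> E \<longrightarrow> \<phi> f = 0)}"

definition dual_norm :: "('a \<Rightarrow> real) set \<Rightarrow> (('a \<Rightarrow> real) \<Rightarrow> real) \<Rightarrow> (('a \<Rightarrow> real) \<Rightarrow> real) \<Rightarrow> real" where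
  "dual_norm E N \<phi> = (SUP f\<in>{f\<in>E. N f \<le> 1}. \<bar>\<phi> f\<bar>)"

definition weak_star_topology ::
  "('a \<Rightarrow> real) set \<Rightarrow> (('a \<Rightarrow> real) \<Rightarrow> real) \<Rightarrow> (('a \<Rightarrow> real) \<Rightarrow> real) topology" where
  "weak_star_topology E N = subtopology (powertop_real UNIV) (dual_space E N)"

definition weak_topology :: "('a \<Rightarrow> real) set \<Rightarrow> (('a \<Rightarrow> real) \<Rightarrow> real) \<Rightarrow> ('a \<Rightarrow> real) topology" where
  "weak_topology E N =
     pullback_topology E (\<lambda>f. \<lambda>\<phi>\<in>dual_space E N. \<phi> f) (powertop_real (dual_space E N))"

definition grothendieck_property :: "('a \<Rightarrow> real) set \<Rightarrow> (('a \<Rightarrow> real) \<Rightarrow> real) \<Rightarrow> bool" where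
  "grothendieck_property E N \<longleftrightarrow>
     (\<forall>\<phi> :: nat \<Rightarrow> ('a \<Rightarrow> real) \<Rightarrow> real.
        range \<phi> \<subseteq> dual_space E N \<longrightarrow>
        (\<exists>l. limitin (weak_star_topology E N) \<phi> l sequentially) \<longrightarrow>
        (\<exists>l. limitin (weak_topology (dual_space E N) (dual_norm E N)) \<phi> l sequentially))"

definition dual_unit_ball :: "('a \<Rightarrow> real) set \<Rightarrow> (('a \<Rightarrow> real) \<Rightarrow> real) \<Rightarrow> (('a \<Rightarrow> real) \<Rightarrow> real) set" where
  "dual_unit_ball E N = {\<phi> \<in> dual_space E N. dual_norm E N \<phi> \<le> 1}"

definition ultrafilters_nat :: "nat filter set" where
  "ultrafilters_nat = {F. F \<noteq> bot \<and> (\<forall>P. eventually P F \<or> eventually (\<lambda>n. \<not> P n) F)}"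

text \<open>The Stone space of the ultrafilters on the natural numbers, fixed ones included.\<close>

definition beta_omega :: "nat filter topology" where
  "beta_omega = topology_generated_by
     (range (\<lambda>A. {F \<in> ultrafilters_nat. eventually (\<lambda>n. n \<in> A) F}))"

definition contains_copy_of :: "'a topology \<Rightarrow> 'b topology \<Rightarrow> bool" where
  "contains_copy_of X Y \<longleftrightarrow> (\<exists>S\<subseteq>topspace X. subtopology X S homeomorphic_space Y)"


section \<open>Signed Radon measures\<close>

definition borel_sets_of :: "'a topology \<Rightarrow> 'a set set" where
  "borel_sets_of X = sigma_sets (topspace X) {U. openin X U}"

definition variation :: "'a topology \<Rightarrow> ('a set \<Rightarrow> real) \<Rightarrow> 'a set \<Rightarrow> real" where
  "variation X \<mu> A =
     Sup {(\<Sum>B\<in>P. \<bar>\<mu> B\<bar>) |P. finite P \<and> disjoint P \<and> P \<subseteq> borel_sets_of X \<and> \<Union>P = A}"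

text \<open>
  The space \<open>M(X)\<close> for a compact Hausdorff space \<open>X\<close>. Set functions vanish off the Borel sets, so
  that they are determined by their values on Borel sets.
\<close>

definition signed_measures :: "'a topology \<Rightarrow> ('a set \<Rightarrow> real) set" where
  "signed_measures X =
     {\<mu>. (\<forall>A. A \<notin> borel_sets_of X \<longrightarrow> \<mu> A = 0) \<and>
         (\<forall>A :: nat \<Rightarrow> 'a set. range A \<subseteq> borel_sets_of X \<longrightarrow> disjoint_family A \<longrightarrow>
            (\<lambda>n. \<mu> (A n)) sums \<mu> (\<Union>n. A n)) \<and>
         (\<forall>A\<in>borel_sets_of X. \<forall>\<epsilon>>0. \<exists>C G. closedin X C \<and> openin X G \<and> C \<subseteq> A \<and> A \<subseteq> G \<and>
            variation X \<mu> (G - C) < \<epsilon>)}"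

definition measure_norm :: "'a topology \<Rightarrow> ('a set \<Rightarrow> real) \<Rightarrow> real" where
  "measure_norm X \<mu> = variation X \<mu> (topspace X)"

text \<open>Jordan decomposition: \<open>\<mu>\<^sup>+ = (|\<mu>| + \<mu>) / 2\<close> and \<open>\<mu>\<^sup>- = (|\<mu>| - \<mu>) / 2\<close>.\<close>

definition positive_part :: "'a topology \<Rightarrow> ('a set \<Rightarrow> real) \<Rightarrow> 'a set \<Rightarrow> real" where
  "positive_part X \<mu> A = (variation X \<mu> A + \<mu> A) / 2"

definition negative_part :: "'a topology \<Rightarrow> ('a set \<Rightarrow> real) \<Rightarrow> 'a set \<Rightarrow> real" where
  "negative_part X \<mu> A = (variation X \<mu> A - \<mu> A) / 2"

definition signed_integral :: "'a topology \<Rightarrow> ('a set \<Rightarrow> real) \<Rightarrow> ('a \<Rightarrow> real) \<Rightarrow> real" where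
  "signed_integral X \<mu> f =
     (LINT x|measure_of (topspace X) (borel_sets_of X) (\<lambda>A. ennreal (positive_part X \<mu> A)). f x) -
     (LINT x|measure_of (topspace X) (borel_sets_of X) (\<lambda>A. ennreal (negative_part X \<mu> A)). f x)"

definition push_forward ::
  "'a topology \<Rightarrow> 'b topology \<Rightarrow> ('a \<Rightarrow> 'b) \<Rightarrow> ('a set \<Rightarrow> real) \<Rightarrow> 'b set \<Rightarrow> real" where
  "push_forward X Y g \<mu> B = (if B \<in> borel_sets_of Y then \<mu> (g -` B \<inter> topspace X) else 0)"

text \<open>Weak-star convergence in \<open>M(X) = C(X)\<^sup>*\<close> as \<open>n \<rightarrow> \<infinity>\<close> along the infinite set \<open>J\<close>.\<close>

definition weak_star_limit_along ::
  "'a topology \<Rightarrow> nat set \<Rightarrow> (nat \<Rightarrow> 'a set \<Rightarrow> real) \<Rightarrow> ('a set \<Rightarrow> real) \<Rightarrow> bool" where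
  "weak_star_limit_along X J \<kappa> \<mu> \<longleftrightarrow>
     (\<forall>f\<in>continuous_functions X.
        ((\<lambda>n. signed_integral X (\<kappa> n) f) \<longlongrightarrow> signed_integral X \<mu> f) (inf sequentially (principal J)))"


section \<open>The countable ordinals\<close>

text \<open>
  \<open>cardSuc natLeq\<close> is the first uncountable cardinal, i.e. a well-order of type \<open>\<omega>\<^sub>1\<close>, so the
  elements of the following type are the countable ordinals.
\<close>

typedef omega1 = "Field (cardSuc natLeq)"
proof -
  have "Field (cardSuc natLeq) \<noteq> {}"
    using Cinfinite_cardSuc[OF natLeq_Cinfinite] unfolding cinfinite_def by auto
  then show ?thesis by blast
qed

instantiation omega1 :: wellorder
begin

definition less_eq_omega1 :: "omega1 \<Rightarrow> omega1 \<Rightarrow> bool" where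
  "a \<le> b \<longleftrightarrow> (Rep_omega1 a, Rep_omega1 b) \<in> cardSuc natLeq"

definition less_omega1 :: "omega1 \<Rightarrow> omega1 \<Rightarrow> bool" where
  "a < b \<longleftrightarrow> a \<le> b \<and> a \<noteq> (b :: omega1)"

instance
proof -
  have wo: "Well_order (cardSuc natLeq)"
    using cardSuc_Card_order[OF natLeq_Card_order] card_order_on_well_order_on by blast
  then have lin: "Linear_order (cardSuc natLeq)" and wf: "wf (cardSuc natLeq - Id)"
    by (auto simp: well_order_on_def)
  then have refl: "\<And>x. x \<in> Field (cardSuc natLeq) \<Longrightarrow> (x, x) \<in> cardSuc natLeq"
    and tr: "trans (cardSuc natLeq)" and an: "antisym (cardSuc natLeq)"
    and tot: "Total (cardSuc natLeq)"
    by (auto simp: order_on_defs refl_on_def)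
  show "OFCLASS(omega1, wellorder_class)"
  proof
    fix a b c :: omega1
    show le: "a \<le> a" by (simp add: less_eq_omega1_def refl Rep_omega1)
    show anti: "a = b" if "a \<le> b" "b \<le> a"
      using that antisymD[OF an] Rep_omega1_inject unfolding less_eq_omega1_def by metis
    show "a \<le> c" if "a \<le> b" "b \<le> c"
      using that tr by (auto simp: less_eq_omega1_def dest: transD)
    show "a < b \<longleftrightarrow> a \<le> b \<and> \<not> b \<le> a"
      using anti le by (auto simp: less_omega1_def)
    show "a \<le> b \<or> b \<le> a"
      using tot refl Rep_omega1[of a] Rep_omega1[of b]
      by (cases "Rep_omega1 a = Rep_omega1 b") (auto simp: less_eq_omega1_def total_on_def)
  next
    fix P :: "omega1 \<Rightarrow> bool" and a :: omega1
    assume step: "\<And>x. (\<And>y. y < x \<Longrightarrow> P y) \<Longrightarrow> P x"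
    have "wf (inv_image (cardSuc natLeq - Id) Rep_omega1)" using wf by (rule wf_inv_image)
    then show "P a"
      by (induction a rule: wf_induct_rule)
         (rule step, auto simp: less_omega1_def less_eq_omega1_def Rep_omega1_inject)
  qed
qed

end

lemma uncountable_omega1: "uncountable (UNIV :: omega1 set)"
proof
  include cardinal_syntax
  assume "countable (UNIV :: omega1 set)"
  then have "countable (Rep_omega1 ` UNIV)" by blast
  then have "countable (Field (cardSuc natLeq))"
    using type_definition.Rep_range[OF type_definition_omega1] by simp
  then have "|Field (cardSuc natLeq)| \<le>o natLeq" by (simp add: countable_card_le_natLeq)
  moreover have "|Field (cardSuc natLeq)| =o cardSuc natLeq"
    by (intro card_of_Field_ordIso cardSuc_Card_order natLeq_Card_order)
  ultimately have "cardSuc natLeq \<le>o natLeq"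
    using ordIso_ordLeq_trans ordIso_symmetric by blast
  then show False
    using cardSuc_greater[OF natLeq_Card_order] not_ordLess_ordLeq by blast
qed

lemma countable_lessThan_omega1: "countable {..<a :: omega1}"
proof -
  include cardinal_syntax
  let ?r = "cardSuc natLeq"
  have co: "Card_order ?r" by (intro cardSuc_Card_order natLeq_Card_order)
  have "|underS ?r (Rep_omega1 a)| <o ?r"
    using card_of_underS[OF co Rep_omega1[of a]] .
  then have "|underS ?r (Rep_omega1 a)| \<le>o natLeq"
    using cardSuc_ordLeq_ordLess[OF natLeq_Card_order card_of_Card_order] by blast
  then have "countable (underS ?r (Rep_omega1 a))" by (simp add: countable_card_le_natLeq)
  moreover have "Rep_omega1 ` {..<a} \<subseteq> underS ?r (Rep_omega1 a)"
    by (auto simp: underS_def less_omega1_def less_eq_omega1_def Rep_omega1_inject)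
  ultimately have "countable (Rep_omega1 ` {..<a})" by (rule countable_subset[rotated])
  then show ?thesis
    by (rule countable_image_inj_on) (simp add: inj_on_def Rep_omega1_inject)
qed

definition omega :: omega1 where
  "omega = (LEAST a. infinite {..<a})"

definition osuc :: "omega1 \<Rightarrow> omega1" where
  "osuc a = (LEAST b. a < b)"


section \<open>Talagrand's construction scheme\<close>

text \<open>
  The ordinal \<open>\<alpha> < \<omega>\<^sub>1\<close> is identified with \<open>{..<\<alpha>}\<close>, and \<open>2\<^sup>\<alpha>\<close> consists of the functions in
  \<open>{..<\<alpha>} \<rightarrow>\<^sub>E UNIV\<close>; the coordinate projection to \<open>2\<^sup>\<beta>\<close> is \<open>\<lambda>t. restrict t {..<\<beta>}\<close>. The index set
  of the final stage is \<open>UNIV\<close>.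
\<close>

definition cube_subspace :: "'i set \<Rightarrow> ('i \<Rightarrow> bool) set \<Rightarrow> ('i \<Rightarrow> bool) topology" where
  "cube_subspace A S = subtopology (product_topology (\<lambda>_. discrete_topology UNIV) A) S"

abbreviation stage :: "(omega1 \<Rightarrow> (omega1 \<Rightarrow> bool) set) \<Rightarrow> omega1 \<Rightarrow> (omega1 \<Rightarrow> bool) topology" where
  "stage K \<alpha> \<equiv> cube_subspace {..<\<alpha>} (K \<alpha>)"

abbreviation proj :: "omega1 \<Rightarrow> (omega1 \<Rightarrow> bool) \<Rightarrow> (omega1 \<Rightarrow> bool)" where
  "proj \<beta> t \<equiv> restrict t {..<\<beta>}"

definition disjoint_clopen_sequences :: "'a topology \<Rightarrow> (nat \<Rightarrow> 'a set) set" where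
  "disjoint_clopen_sequences X =
     {s. (\<forall>n. closedin X (s n) \<and> openin X (s n) \<and> s n \<noteq> {}) \<and> disjoint_family s}"

text \<open>The sets \<open>V\<^sub>n(\<theta>, \<alpha>)\<close>.\<close>

definition scheduled_set ::
  "(omega1 \<Rightarrow> (omega1 \<Rightarrow> bool) set) \<Rightarrow> (omega1 \<Rightarrow> omega1 \<times> omega1) \<Rightarrow>
   (omega1 \<Rightarrow> omega1 \<Rightarrow> nat \<Rightarrow> (omega1 \<Rightarrow> bool) set) \<Rightarrow>
   omega1 \<Rightarrow> omega1 \<Rightarrow> nat \<Rightarrow> (omega1 \<Rightarrow> bool) set" where
  "scheduled_set K \<eta> U \<theta> \<alpha> n = (case \<eta> \<theta> of (\<beta>, \<gamma>) \<Rightarrow> {t \<in> K \<alpha>. proj \<beta> t \<in> U \<beta> \<gamma> n})"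

text \<open>The set of choice sequences: all \<open>\<kappa>\<close> with \<open>\<kappa> n \<in> B\<^sub>n(\<theta>, \<delta>, \<alpha>)\<close> for every \<open>n\<close>.\<close>

definition lift_choices ::
  "(omega1 \<Rightarrow> (omega1 \<Rightarrow> bool) set) \<Rightarrow>
   (omega1 \<Rightarrow> omega1 \<Rightarrow> nat \<Rightarrow> (omega1 \<Rightarrow> bool) set \<Rightarrow> real) \<Rightarrow>
   omega1 \<Rightarrow> omega1 \<Rightarrow> omega1 \<Rightarrow> (nat \<Rightarrow> (omega1 \<Rightarrow> bool) set \<Rightarrow> real) set" where
  "lift_choices K \<nu> \<theta> \<delta> \<alpha> =
     {\<kappa>. \<forall>n. \<kappa> n \<in> signed_measures (stage K \<alpha>) \<and> measure_norm (stage K \<alpha>) (\<kappa> n) = 1 \<and>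
          push_forward (stage K \<alpha>) (stage K \<theta>) (proj \<theta>) (\<kappa> n) = \<nu> \<theta> \<delta> n}"

text \<open>
  Values of the parameters outside the index ranges of the scheme (e.g. \<open>K \<alpha>\<close> for \<open>\<alpha> < \<omega>\<close>) are
  irrelevant. For \<open>\<alpha> \<ge> \<omega>\<close> the first component of \<open>\<eta> \<alpha>\<close> is at least \<open>\<omega>\<close>, since stages are only
  indexed from \<open>\<omega>\<close> on and \<open>V\<^sub>n(\<alpha>, \<cdot>)\<close> would be undefined otherwise. The continuum hypothesis is not
  a separate assumption: it follows from the enumeration \<open>U_enum\<close> of length \<open>\<omega>\<^sub>1\<close> at \<open>\<beta> = \<omega>\<close>.
\<close>

locale talagrand_realisation =
  fixes K Y Z :: "omega1 \<Rightarrow> (omega1 \<Rightarrow> bool) set"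
    and \<eta> :: "omega1 \<Rightarrow> omega1 \<times> omega1"
    and U :: "omega1 \<Rightarrow> omega1 \<Rightarrow> nat \<Rightarrow> (omega1 \<Rightarrow> bool) set"
    and \<nu> :: "omega1 \<Rightarrow> omega1 \<Rightarrow> nat \<Rightarrow> (omega1 \<Rightarrow> bool) set \<Rightarrow> real"
    and I :: "omega1 \<Rightarrow> omega1 \<Rightarrow> nat set"
    and J :: "omega1 \<Rightarrow> omega1 \<Rightarrow> omega1 \<Rightarrow> nat set"
    and N\<^sub>0 N\<^sub>1 :: "omega1 \<Rightarrow> omega1 \<Rightarrow> nat set"
  assumes K_omega: "K omega = {..<omega} \<rightarrow>\<^sub>E UNIV"
    and Y_Z_closed: "\<And>\<alpha>. omega \<le> \<alpha> \<Longrightarrow> closedin (stage K \<alpha>) (Y \<alpha>) \<and> closedin (stage K \<alpha>) (Z \<alpha>)"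
    and Y_Z_cover: "\<And>\<alpha>. omega \<le> \<alpha> \<Longrightarrow> Y \<alpha> \<union> Z \<alpha> = K \<alpha>"
    and K_osuc: "\<And>\<alpha>. omega \<le> \<alpha> \<Longrightarrow>
          K (osuc \<alpha>) = (\<lambda>t. t(\<alpha> := False)) ` Y \<alpha> \<union> (\<lambda>t. t(\<alpha> := True)) ` Z \<alpha>"
    and K_limit: "\<And>\<rho>. omega < \<rho> \<Longrightarrow> (\<forall>\<alpha>. \<rho> \<noteq> osuc \<alpha>) \<Longrightarrow>
          K \<rho> = {t \<in> {..<\<rho>} \<rightarrow>\<^sub>E UNIV. \<forall>\<alpha>. omega \<le> \<alpha> \<and> \<alpha> < \<rho> \<longrightarrow> proj \<alpha> t \<in> K \<alpha>}"
    and \<eta>_le: "\<And>\<alpha>. fst (\<eta> \<alpha>) \<le> \<alpha> \<and> snd (\<eta> \<alpha>) \<le> \<alpha>"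
    and \<eta>_ge: "\<And>\<alpha>. omega \<le> \<alpha> \<Longrightarrow> omega \<le> fst (\<eta> \<alpha>)"
    and \<eta>_onto: "\<And>\<theta> \<delta>. omega \<le> \<theta> \<Longrightarrow> \<exists>\<alpha>. \<eta> \<alpha> = (\<theta>, \<delta>)"
    and U_enum: "\<And>\<beta>. omega \<le> \<beta> \<Longrightarrow> range (U \<beta>) = disjoint_clopen_sequences (stage K \<beta>)"
    and \<nu>_enum: "\<And>\<theta>. omega \<le> \<theta> \<Longrightarrow>
          range (\<nu> \<theta>) =
            {s. \<forall>n. s n \<in> signed_measures (stage K \<theta>) \<and>
                    measure_norm (stage K \<theta>) (s n) = 1 \<and>
                    variation (stage K \<theta>) (s n) (scheduled_set K \<eta> U \<theta> \<theta> n) = 1 \<and>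
                    measure_norm (stage K \<theta>) (positive_part (stage K \<theta>) (s n)) \<ge> 1 / 2}"
    and A: "\<And>\<theta> \<delta> \<alpha>. omega \<le> \<theta> \<Longrightarrow> \<theta> < \<alpha> \<Longrightarrow> \<delta> < \<alpha> \<Longrightarrow> J \<theta> \<delta> \<alpha> \<subseteq> I \<theta> \<alpha>"
    and B: "\<And>\<theta> \<delta>. omega \<le> \<theta> \<Longrightarrow> N\<^sub>0 \<theta> \<delta> \<inter> N\<^sub>1 \<theta> \<delta> = {}"
    and C: "\<And>\<theta> \<delta> \<alpha>. omega \<le> \<theta> \<Longrightarrow> \<theta> < \<alpha> \<Longrightarrow> \<delta> < \<alpha> \<Longrightarrow>
          infinite (J \<theta> \<delta> \<alpha> \<inter> N\<^sub>0 \<theta> \<delta>) \<and> infinite (J \<theta> \<delta> \<alpha> \<inter> N\<^sub>1 \<theta> \<delta>)"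
    and D_J: "\<And>\<theta> \<delta> \<alpha>' \<alpha>. omega \<le> \<theta> \<Longrightarrow> \<theta> < \<alpha>' \<Longrightarrow> \<delta> < \<alpha>' \<Longrightarrow> \<alpha>' \<le> \<alpha> \<Longrightarrow>
          finite (J \<theta> \<delta> \<alpha> - J \<theta> \<delta> \<alpha>')"
    and D_I: "\<And>\<theta> \<alpha>' \<alpha>. omega \<le> \<theta> \<Longrightarrow> \<theta> < \<alpha>' \<Longrightarrow> \<alpha>' \<le> \<alpha> \<Longrightarrow> finite (I \<theta> \<alpha> - I \<theta> \<alpha>')"
    and E: "\<And>\<theta> \<alpha>' \<alpha>. omega \<le> \<theta> \<Longrightarrow> \<theta> \<le> \<alpha>' \<Longrightarrow> \<alpha>' < \<alpha> \<Longrightarrow>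
          \<forall>\<^sub>F n in sequentially. n \<in> I \<theta> \<alpha> \<longrightarrow>
            (\<forall>t\<in>scheduled_set K \<eta> U \<theta> \<alpha> n. \<forall>t'\<in>scheduled_set K \<eta> U \<theta> \<alpha> n.
               proj \<theta> t = proj \<theta> t' \<longrightarrow> t \<alpha>' = t' \<alpha>')"
    and F: "\<And>\<theta> \<delta> \<alpha> \<kappa>. omega \<le> \<theta> \<Longrightarrow> \<theta> < \<alpha> \<Longrightarrow> \<delta> < \<alpha> \<Longrightarrow>
          \<kappa> \<in> lift_choices K \<nu> \<theta> \<delta> \<alpha> \<Longrightarrow>
          \<exists>\<mu>\<in>signed_measures (stage K \<alpha>). weak_star_limit_along (stage K \<alpha>) (J \<theta> \<delta> \<alpha>) \<kappa> \<mu>"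
    and G: "\<And>\<alpha>' \<theta> \<delta> \<kappa>. omega \<le> \<alpha>' \<Longrightarrow> \<eta> \<alpha>' = (\<theta>, \<delta>) \<Longrightarrow>
          \<kappa> \<in> lift_choices K \<nu> \<theta> \<delta> (osuc \<alpha>') \<Longrightarrow>
          infinite {n. \<kappa> n ((\<lambda>t. t(\<alpha>' := True)) ` Z \<alpha>') \<ge> 1 / 6} \<and>
          infinite {n. \<kappa> n ((\<lambda>t. t(\<alpha>' := True)) ` Z \<alpha>') = 0}"

text \<open>The final stage \<open>K\<^bsub>\<omega>\<^sub>1\<^esub>\<close>, the inverse limit of all \<open>K\<^sub>\<alpha>\<close> with \<open>\<omega> \<le> \<alpha> < \<omega>\<^sub>1\<close>.\<close>

definition talagrand_compactum :: "(omega1 \<Rightarrow> bool) topology \<Rightarrow> bool" where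
  "talagrand_compactum X \<longleftrightarrow>
     (\<exists>K Y Z \<eta> U \<nu> I J N\<^sub>0 N\<^sub>1.
        talagrand_realisation K Y Z \<eta> U \<nu> I J N\<^sub>0 N\<^sub>1 \<and>
        X = cube_subspace UNIV {t. \<forall>\<alpha>. omega \<le> \<alpha> \<longrightarrow> proj \<alpha> t \<in> K \<alpha>})"

end

theory Submission
  imports Defs
begin

text \<open>
  Of Talagrand's construction only the compactness of \<open>X\<close> is used. Let \<open>q\<close> be a quotient map of
  \<open>C\<^sub>p(X)\<close> onto a sequence space. Its coordinates are pointwise continuous functionals, that is,
  finitely supported measures \<open>a\<^sub>n\<close>.

  If the sequence space is contained in \<open>c\<^sub>0\<close>, the \<open>a\<^sub>n\<close> are weak-star null, hence weakly null by the
  Grothendieck property, hence \<open>\<integral> g da\<^sub>n \<rightarrow> 0\<close> for all bounded \<open>g\<close>, continuous or not, and a gliding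
  hump gives \<open>\<parallel>a\<^sub>n\<parallel> < 4\<^sup>-\<^sup>k\<close> for some \<open>n = n\<^sub>k\<close>. So no sequence with entries \<open>2\<^sup>-\<^sup>k\<close> at \<open>n\<^sub>k\<close> is in the range.

  If the sequence space is \<open>\<ell>\<^sub>\<infinity>\<close>, the \<open>a\<^sub>n\<close> are uniformly bounded and, after scaling,
  \<open>F \<mapsto> lim\<^sub>F a\<^sub>n\<close> maps \<open>\<beta>\<omega>\<close> into the dual ball. Functions mapped by \<open>q\<close> to indicators of sets
  \<open>A \<subseteq> \<omega>\<close> show that this map is an embedding.
\<close>

section \<open>Continuous functions on a compact space\<close>

lemma topspace_pointwise_topology [simp]: "topspace (pointwise_topology E) = E"
  by (simp add: pointwise_topology_def)

text \<open>\<open>SUP\<close> of a set of reals means something only if the set is bounded above;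
  the bound \<open>B\<close> supplies this.\<close>

lemma abs_le_sup_norm:
  assumes "\<And>x. \<bar>f x\<bar> \<le> B"
  shows "\<bar>f x\<bar> \<le> sup_norm f"
  unfolding sup_norm_def by (rule cSUP_upper) (use assms in \<open>auto intro!: bdd_aboveI\<close>)

lemma sup_norm_le: "(\<And>x. \<bar>f x\<bar> \<le> B) \<Longrightarrow> sup_norm f \<le> B"
  unfolding sup_norm_def by (rule cSUP_least) auto

lemma continuous_functions_bounded:
  assumes "compact_space X" "f \<in> continuous_functions X"
  obtains B where "\<And>x. \<bar>f x\<bar> \<le> B"
proof -
  have "compact (f ` topspace X)"
    using assms image_compactin[of X "topspace X" euclideanreal f]
    by (simp add: continuous_functions_def compact_space_def)
  then obtain B where B: "\<And>y. y \<in> f ` topspace X \<Longrightarrow> \<bar>y\<bar> \<le> B"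
    using compact_imp_bounded bounded_real by metis
  have "\<bar>f x\<bar> \<le> max B 0" for x
    using B[of "f x"] assms(2) by (cases "x \<in> topspace X") (auto simp: continuous_functions_def)
  then show thesis by (rule that)
qed

lemma continuous_functions_le_sup_norm:
  assumes "compact_space X" "f \<in> continuous_functions X"
  shows "\<bar>f x\<bar> \<le> sup_norm f"
  using continuous_functions_bounded[OF assms] abs_le_sup_norm by metis

lemma continuous_functions_zero: "(\<lambda>x. 0) \<in> continuous_functions X"
  by (simp add: continuous_functions_def)

lemma continuous_functions_add:
  "f \<in> continuous_functions X \<Longrightarrow> g \<in> continuous_functions X \<Longrightarrow>
    (\<lambda>x. f x + g x) \<in> continuous_functions X"
  by (auto simp: continuous_functions_def intro!: continuous_map_add)

lemma continuous_functions_scale: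
  "f \<in> continuous_functions X \<Longrightarrow> (\<lambda>x. c * f x) \<in> continuous_functions X"
  by (auto simp: continuous_functions_def intro!: continuous_map_real_mult)

lemma continuous_functions_sum:
  "finite S \<Longrightarrow> (\<And>i. i \<in> S \<Longrightarrow> f i \<in> continuous_functions X) \<Longrightarrow>
    (\<lambda>x. \<Sum>i\<in>S. f i x) \<in> continuous_functions X"
  by (induction S rule: finite_induct)
     (auto intro: continuous_functions_add continuous_functions_zero)

text \<open>Completeness of C(X) in the form needed for the uniform boundedness argument: the rate
  \<open>r\<close> does not depend on the point, so the limit is uniform, and off \<open>X\<close>
  every \<open>F n\<close> vanishes.\<close>

lemma continuous_functions_uniform_limit:
  assumes F: "\<And>n. F n \<in> continuous_functions X"
    and lim: "\<And>n x. \<bar>f x - F n x\<bar> \<le> r n" "r \<longlonglongrightarrow> 0"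
  shows "f \<in> continuous_functions X"
proof -
  have "continuous_map X euclideanreal f"
    unfolding mtopology_is_euclidean[symmetric]
  proof (rule Met_TC.continuous_map_uniform_limit[where f = F and F = sequentially])
    show "\<forall>\<^sub>F n in sequentially. continuous_map X Met_TC.mtopology (F n)"
      using F by (simp add: continuous_functions_def)
    show "\<forall>\<^sub>F n in sequentially. \<forall>x\<in>topspace X. f x \<in> UNIV \<and> dist (F n x) (f x) < \<epsilon>"
      if "0 < \<epsilon>" for \<epsilon>
      using order_tendstoD(2)[OF lim(2) that]
      by eventually_elim (metis lim(1) UNIV_I dist_commute dist_real_def le_less_trans)
  qed auto
  moreover have "f x = 0" if "x \<notin> topspace X" for x
  proof -
    have "\<bar>f x\<bar> \<le> r n" for n
      using lim(1)[of x n] F[of n] that by (simp add: continuous_functions_def)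
    then have "\<bar>f x\<bar> \<le> 0" using lim(2) by (intro LIMSEQ_le_const[OF lim(2)]) auto
    then show ?thesis by simp
  qed
  ultimately show ?thesis by (simp add: continuous_functions_def)
qed

text \<open>A finite subset of a compact Hausdorff space is closed and discrete, so any
  \<open>g\<close> is continuous on it, and Tietze's theorem extends it without raising the bound.
  The extension is then reset to 0 off \<open>X\<close>.\<close>

lemma continuous_functions_interpolate:
  assumes "compact_space X" "Hausdorff_space X" "finite S" "S \<subseteq> topspace X"
    and g: "\<And>x. x \<in> S \<Longrightarrow> \<bar>g x\<bar> \<le> B" and "0 \<le> B"
  obtains f where "f \<in> continuous_functions X" "\<And>x. x \<in> S \<Longrightarrow> f x = g x" "\<And>x. \<bar>f x\<bar> \<le> B"
proof -
  have t1: "t1_space X" using assms(2) by (rule Hausdorff_imp_t1_space)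
  have "subtopology X S = discrete_topology S"
    using assms(3,4) t1 by (intro finite_t1_space_imp_discrete_topology t1_space_subtopology) auto
  moreover have "closedin X S" using t1 assms(3,4) t1_space_closedin_finite by blast
  moreover have "normal_space X"
    using assms(1,2) compact_Hausdorff_or_regular_imp_normal_space by blast
  moreover have "g ` S \<subseteq> {-B..B}" using g by (force simp: abs_le_iff)
  ultimately obtain h where h: "continuous_map X euclideanreal h" "\<And>x. x \<in> S \<Longrightarrow> h x = g x"
      "h ` topspace X \<subseteq> {-B..B}"
    using Tietze_extension_closed_real_interval[of X S g "-B" B] \<open>0 \<le> B\<close> by auto
  define f where "f x = (if x \<in> topspace X then h x else 0)" for x
  have "continuous_map X euclideanreal f"
    using h(1) by (rule continuous_map_eq) (simp add: f_def)
  then have "f \<in> continuous_functions X" by (simp add: continuous_functions_def f_def)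
  moreover have "f x = g x" if "x \<in> S" for x using that assms(4) h(2) by (auto simp: f_def)
  moreover have "\<bar>f x\<bar> \<le> B" for x using h(3) \<open>0 \<le> B\<close> by (force simp: f_def abs_le_iff)
  ultimately show thesis by (rule that)
qed

section \<open>Functionals continuous in the pointwise topology\<close>

lemma linear_functional_add:
  "linear_functional_on E \<phi> \<Longrightarrow> f \<in> E \<Longrightarrow> g \<in> E \<Longrightarrow> \<phi> (\<lambda>x. f x + g x) = \<phi> f + \<phi> g"
  by (simp add: linear_functional_on_def)

lemma linear_functional_scale:
  "linear_functional_on E \<phi> \<Longrightarrow> f \<in> E \<Longrightarrow> \<phi> (\<lambda>x. c * f x) = c * \<phi> f"
  by (simp add: linear_functional_on_def)

lemma linear_functional_sum:
  assumes "linear_functional_on (continuous_functions X) \<phi>" "finite S"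
    and "\<And>i. i \<in> S \<Longrightarrow> f i \<in> continuous_functions X"
  shows "\<phi> (\<lambda>x. \<Sum>i\<in>S. c i * f i x) = (\<Sum>i\<in>S. c i * \<phi> (f i))"
  using assms(2,3)
proof (induction S rule: finite_induct)
  case empty
  show ?case
    using linear_functional_scale[OF assms(1) continuous_functions_zero, of 0] by simp
next
  case (insert i S)
  have "(\<lambda>x. \<Sum>j\<in>S. c j * f j x) \<in> continuous_functions X"
    using insert by (intro continuous_functions_sum continuous_functions_scale) auto
  moreover have "(\<lambda>x. c i * f i x) \<in> continuous_functions X"
    using insert by (intro continuous_functions_scale) auto
  ultimately have "\<phi> (\<lambda>x. c i * f i x + (\<Sum>j\<in>S. c j * f j x)) =
      \<phi> (\<lambda>x. c i * f i x) + \<phi> (\<lambda>x. \<Sum>j\<in>S. c j * f j x)"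
    by (intro linear_functional_add[OF assms(1)])
  moreover have "\<phi> (\<lambda>x. c i * f i x) = c i * \<phi> (f i)"
    using insert by (intro linear_functional_scale[OF assms(1)]) auto
  ultimately show ?case using insert by simp
qed

text \<open>
  A pointwise neighbourhood of \<open>0\<close> on which \<open>\<phi>\<close> is bounded contains every function vanishing on
  some finite set; by homogeneity \<open>\<phi>\<close> vanishes at these functions.
\<close>

lemma pointwise_continuous_functional_finite_support:
  assumes X: "compact_space X" "Hausdorff_space X"
    and lin: "linear_functional_on (continuous_functions X) \<phi>"
    and cont: "continuous_map (pointwise_topology (continuous_functions X)) euclideanreal \<phi>"
  obtains a where "finite {x. a x \<noteq> 0}" "{x. a x \<noteq> 0} \<subseteq> topspace X"
    "\<And>f. f \<in> continuous_functions X \<Longrightarrow> \<phi> f = (\<Sum>x | a x \<noteq> 0. a x * f x)"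
proof -
  let ?C = "continuous_functions X"
  have zero: "\<phi> (\<lambda>x. 0) = 0"
    using linear_functional_sum[OF lin, of "{}"] by simp
  have "openin (pointwise_topology ?C) {f \<in> ?C. \<phi> f \<in> ball 0 1}"
    using openin_continuous_map_preimage[OF cont, of "ball 0 1"] by simp
  then obtain W where W: "openin (powertop_real UNIV) W"
      "{f \<in> ?C. \<phi> f \<in> ball 0 1} = W \<inter> ?C"
    unfolding pointwise_topology_def openin_subtopology by blast
  have "(\<lambda>x. 0) \<in> {f \<in> ?C. \<phi> f \<in> ball 0 1}"
    using zero continuous_functions_zero[of X] by simp
  then have "(\<lambda>x. 0) \<in> W" unfolding W(2) by blast
  then obtain N where N: "finite {x. N x \<noteq> (UNIV :: real set)}" "(\<lambda>x. 0) \<in> Pi\<^sub>E UNIV N" "Pi\<^sub>E UNIV N \<subseteq> W"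
    using openin_product_topology_alt[THEN iffD1, OF W(1)] by auto
  \<comment> \<open>Constrained coordinates off \<open>X\<close> may be dropped: members of
    \<open>?C\<close> are 0 there, as is the function around which the box \<open>N\<close> was
    chosen.\<close>
  define S where "S = {x. N x \<noteq> UNIV} \<inter> topspace X"
  have S: "finite S" "S \<subseteq> topspace X" using N(1) by (auto simp: S_def)
  have vanish: "\<phi> f = 0" if f: "f \<in> ?C" "\<And>x. x \<in> S \<Longrightarrow> f x = 0" for f
  proof -
    have small: "\<bar>c * \<phi> f\<bar> < 1" for c
    proof -
      have "c * f x \<in> N x" for x
      proof (cases "x \<in> S \<or> x \<notin> topspace X")
        case True
        then have "f x = 0" using f by (auto simp: continuous_functions_def)
        then show ?thesis using N(2) by (auto simp: PiE_iff)
      qed (auto simp: S_def)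
      then have "(\<lambda>x. c * f x) \<in> W" using N(3) by auto
      then have "\<phi> (\<lambda>x. c * f x) \<in> ball 0 1"
        using W(2) continuous_functions_scale[OF f(1)] by blast
      then show ?thesis
        by (simp add: linear_functional_scale[OF lin f(1)] dist_real_def)
    qed
    \<comment> \<open>If \<open>\<phi> f\<close> were nonzero, \<open>c = 1 / \<phi> f\<close> would
      give the value 1, which is not below 1.\<close>
    show ?thesis
      using small[of "1 / \<phi> f"] by (cases "\<phi> f = 0") auto
  qed
  have "\<exists>h\<in>?C. \<forall>y\<in>S. h y = (if y = x then 1 else 0)" for x
    by (rule continuous_functions_interpolate[OF X S, of "\<lambda>y. if y = x then 1 else 0" 1])
      (simp_all, metis)
  then obtain h where h: "\<And>x. h x \<in> ?C" "\<And>x y. y \<in> S \<Longrightarrow> h x y = (if y = x then 1 else 0)"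
    by metis
  define a where "a x = (if x \<in> S then \<phi> (h x) else 0)" for x
  have "\<phi> f = (\<Sum>x | a x \<noteq> 0. a x * f x)" if f: "f \<in> ?C" for f
  proof -
    \<comment> \<open>The \<open>h x\<close> are dual to the points of \<open>S\<close>, so
      \<open>?g\<close> agrees with \<open>f\<close> on \<open>S\<close> and \<open>vanish\<close>
      applies to the difference.\<close>
    let ?g = "\<lambda>y. \<Sum>x\<in>S. f x * h x y"
    have g: "?g \<in> ?C" using h(1) S(1) by (intro continuous_functions_sum continuous_functions_scale)
    have "(\<lambda>y. f y + (-1) * ?g y) \<in> ?C"
      by (intro continuous_functions_add continuous_functions_scale[OF g] f)
    moreover have "f y + (-1) * ?g y = 0" if "y \<in> S" for y
    proof -
      have "?g y = (\<Sum>x\<in>S. if y = x then f x else 0)"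
        by (rule sum.cong) (simp_all add: h(2)[OF that])
      then show ?thesis using that S(1) by simp
    qed
    ultimately have "\<phi> (\<lambda>y. f y + (-1) * ?g y) = 0" using vanish by blast
    moreover have "\<phi> (\<lambda>y. f y + (-1) * ?g y) = \<phi> f + \<phi> (\<lambda>y. (-1) * ?g y)"
      by (intro linear_functional_add[OF lin f] continuous_functions_scale[OF g])
    moreover have "\<phi> (\<lambda>y. (-1) * ?g y) = (-1) * \<phi> ?g"
      by (rule linear_functional_scale[OF lin g])
    ultimately have "\<phi> f = \<phi> ?g" by linarith
    also have "\<dots> = (\<Sum>x\<in>S. f x * \<phi> (h x))"
      using linear_functional_sum[OF lin S(1)] h(1) by blast
    also have "\<dots> = (\<Sum>x | a x \<noteq> 0. a x * f x)"
      by (rule sum.mono_neutral_cong_right) (use S(1) in \<open>auto simp: a_def\<close>)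
    finally show ?thesis .
  qed
  then show thesis by (intro that[of a]) (use S in \<open>auto simp: a_def intro: finite_subset\<close>)
qed

section \<open>Uniform boundedness\<close>

text \<open>The constant from \<open>dual_space\<close> bounds the values on the unit ball, so that
  the supremum is a genuine one. It may be negative, hence the passage to
  \<open>max C 0\<close>.\<close>

lemma abs_le_dual_norm:
  assumes \<phi>: "\<phi> \<in> dual_space E N" and nonneg: "\<And>f. f \<in> E \<Longrightarrow> 0 \<le> N f"
    and f: "f \<in> E" "N f \<le> 1"
  shows "\<bar>\<phi> f\<bar> \<le> dual_norm E N \<phi>"
proof -
  obtain C where C: "\<And>f. f \<in> E \<Longrightarrow> \<bar>\<phi> f\<bar> \<le> C * N f" using \<phi> by (auto simp: dual_space_def)
  have "\<bar>\<phi> f\<bar> \<le> max C 0" if "f \<in> E" "N f \<le> 1" for f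
  proof -
    have "\<bar>\<phi> f\<bar> \<le> max C 0 * N f"
      using C[OF that(1)] mult_right_mono[OF max.cobounded1[of C 0] nonneg[OF that(1)]] by linarith
    also have "\<dots> \<le> max C 0" using that nonneg by (simp add: mult_left_le)
    finally show ?thesis .
  qed
  then show ?thesis
    unfolding dual_norm_def using f by (intro cSUP_upper) (auto intro!: bdd_aboveI)
qed

lemma sup_norm_nonneg:
  assumes "compact_space X" "f \<in> continuous_functions X"
  shows "0 \<le> sup_norm f"
  using continuous_functions_le_sup_norm[OF assms, of undefined] by linarith

lemma abs_le_dual_norm_sup_norm:
  assumes X: "compact_space X" and \<phi>: "\<phi> \<in> dual_space (continuous_functions X) sup_norm"
    and f: "f \<in> continuous_functions X" "\<And>x. \<bar>f x\<bar> \<le> r"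
  shows "\<bar>\<phi> f\<bar> \<le> dual_norm (continuous_functions X) sup_norm \<phi> * r"
proof (cases "r > 0")
  case True
  have "\<bar>\<phi> (\<lambda>x. inverse r * f x)\<bar> \<le> dual_norm (continuous_functions X) sup_norm \<phi>"
  proof (rule abs_le_dual_norm[OF \<phi> sup_norm_nonneg[OF X]])
    show "(\<lambda>x. inverse r * f x) \<in> continuous_functions X"
      by (intro continuous_functions_scale f)
    show "sup_norm (\<lambda>x. inverse r * f x) \<le> 1"
      using f(2) True by (intro sup_norm_le) (simp add: abs_mult field_simps)
  qed
  moreover have "\<phi> (\<lambda>x. inverse r * f x) = inverse r * \<phi> f"
    using \<phi> f(1) by (intro linear_functional_scale) (auto simp: dual_space_def)
  ultimately have "inverse r * \<bar>\<phi> f\<bar> \<le> dual_norm (continuous_functions X) sup_norm \<phi>"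
    using True by (simp add: abs_mult)
  then show ?thesis using True by (simp add: field_simps)
next
  case False
  \<comment> \<open>A bound \<open>r\<close> that is not positive must be 0, and then
    \<open>sup_norm f\<close> and \<open>\<phi> f\<close> vanish too.\<close>
  obtain C where "\<bar>\<phi> f\<bar> \<le> C * sup_norm f" using \<phi> f(1) by (auto simp: dual_space_def)
  moreover have "sup_norm f = 0" "r = 0"
    using sup_norm_le[of f r, OF f(2)] sup_norm_nonneg[OF X f(1)] False by auto
  ultimately show ?thesis by simp
qed

lemma dual_norm_sup_norm_le:
  assumes "compact_space X"
    and "\<And>f. f \<in> continuous_functions X \<Longrightarrow> (\<And>x. \<bar>f x\<bar> \<le> 1) \<Longrightarrow> \<bar>\<phi> f\<bar> \<le> B"
  shows "dual_norm (continuous_functions X) sup_norm \<phi> \<le> B"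
  unfolding dual_norm_def
proof (rule cSUP_least)
  show "{f \<in> continuous_functions X. sup_norm f \<le> 1} \<noteq> {}"
    using continuous_functions_zero[of X] sup_norm_le[of "\<lambda>x. 0" 1] by auto
  show "\<bar>\<phi> f\<bar> \<le> B" if "f \<in> {f \<in> continuous_functions X. sup_norm f \<le> 1}" for f
    using that continuous_functions_le_sup_norm[OF assms(1), of f]
    by (intro assms(2)) (auto intro: order_trans)
qed

section \<open>Banach-Steinhaus theorem for C(X)\<close>

text \<open>The radius is the tail of the geometric series from \<open>k\<close> on. Hence the
  intervals of this radius around \<open>u k\<close> are nested, and the supremum of their left ends
  lies in all of them.\<close>

lemma geometric_increments_limit:
  fixes u :: "nat \<Rightarrow> real"
  assumes "\<And>k. \<bar>u (Suc k) - u k\<bar> \<le> (1/3) ^ k"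
  obtains l where "\<And>k. \<bar>l - u k\<bar> \<le> 3/2 * (1/3) ^ k"
proof -
  let ?v = "\<lambda>k. u k - 3/2 * (1/3) ^ k" and ?w = "\<lambda>k. u k + 3/2 * (1/3) ^ k"
  have "?v k \<le> ?v (Suc k)" "?w (Suc k) \<le> ?w k" for k
    using assms[of k] by (auto simp: abs_le_iff)
  then have "incseq ?v" "decseq ?w" by (simp_all add: incseq_SucI decseq_SucI)
  then have vw: "?v i \<le> ?w j" for i j
  proof -
    have "?v i \<le> ?v (max i j)" using \<open>incseq ?v\<close> by (rule incseqD) simp
    also have "\<dots> \<le> ?w (max i j)" by simp
    also have "\<dots> \<le> ?w j" using \<open>decseq ?w\<close> by (rule decseqD) simp
    finally show ?thesis .
  qed
  have lower: "?v k \<le> (SUP i. ?v i)" for k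
    using vw[of _ 0] by (intro cSUP_upper) (auto intro!: bdd_aboveI)
  have upper: "(SUP i. ?v i) \<le> ?w k" for k using vw by (intro cSUP_least) auto
  have "\<bar>(SUP i. ?v i) - u k\<bar> \<le> 3/2 * (1/3) ^ k" for k
    using lower[of k] upper[of k] by linarith
  then show thesis by (rule that)
qed

text \<open>
  Sokal's proof: one of \<open>f \<plusminus> 3\<^sup>-\<^sup>k h\<close>, with \<open>h\<close> nearly norming for \<open>\<phi> (n k)\<close>, has a large image under
  \<open>\<phi> (n k)\<close>, and later steps are too small to undo this.
\<close>

lemma banach_steinhaus_continuous_functions:
  assumes X: "compact_space X"
    and \<phi>: "\<And>n::nat. \<phi> n \<in> dual_space (continuous_functions X) sup_norm"
    and bd: "\<And>f. f \<in> continuous_functions X \<Longrightarrow> bounded (range (\<lambda>n. \<phi> n f))"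
  obtains M where "\<And>n. dual_norm (continuous_functions X) sup_norm (\<phi> n) \<le> M"
proof (rule ccontr)
  let ?C = "continuous_functions X" and ?d = "\<lambda>n. dual_norm (continuous_functions X) sup_norm (\<phi> n)"
  assume "\<not> thesis"
  then have "\<exists>n. M < ?d n" for M using that[of M] not_le by blast
  \<comment> \<open>The base 4 exceeds the 3 of the step sizes \<open>(1/3) ^ k\<close>, so the
    products \<open>(1/3) ^ k * ?d (n k)\<close> are still unbounded.\<close>
  then have "\<forall>k::nat. \<exists>n. 4 ^ k < ?d n" by blast
  from choice[OF this] obtain n where n: "\<And>k. 4 ^ k < ?d (n k)" by blast
  have "\<exists>h\<in>?C. (\<forall>x. \<bar>h x\<bar> \<le> 1) \<and> 3/4 * ?d (n k) < \<bar>\<phi> (n k) h\<bar>" for k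
  proof (rule ccontr)
    assume *: "\<not> ?thesis"
    have "?d (n k) \<le> 3/4 * ?d (n k)"
    proof (rule dual_norm_sup_norm_le[OF X], rule ccontr)
      fix f assume "f \<in> ?C" "\<And>x. \<bar>f x\<bar> \<le> 1" "\<not> \<bar>\<phi> (n k) f\<bar> \<le> 3/4 * ?d (n k)"
      then have "f \<in> ?C" "\<forall>x. \<bar>f x\<bar> \<le> 1" "3/4 * ?d (n k) < \<bar>\<phi> (n k) f\<bar>" by auto
      then show False using * by blast
    qed
    then show False using n[of k] zero_less_power[of "4::real" k] by linarith
  qed
  then obtain h where h: "\<And>k. h k \<in> ?C" "\<And>k x. \<bar>h k x\<bar> \<le> 1"
      "\<And>k. 3/4 * ?d (n k) < \<bar>\<phi> (n k) (h k)\<bar>" by metis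
  have lin: "\<phi> m (\<lambda>x. f x + c * g x) = \<phi> m f + c * \<phi> m g" if "f \<in> ?C" "g \<in> ?C" for m f g c
  proof -
    have "linear_functional_on ?C (\<phi> m)" using \<phi>[of m] by (simp add: dual_space_def)
    note add = linear_functional_add[OF this] and scale = linear_functional_scale[OF this]
    show ?thesis
      using add[OF that(1) continuous_functions_scale[OF that(2)]] scale[OF that(2)] by simp
  qed
  \<comment> \<open>Half the difference of the two candidate images under
    \<open>\<phi> (n k)\<close> is \<open>(1/3) ^ k * \<phi> (n k) (h k)\<close>, so at least one of
    them is that large in absolute value.\<close>
  define step where "step k f = (if \<bar>\<phi> (n k) (\<lambda>x. f x + (1/3) ^ k * h k x)\<bar> \<ge> (1/3) ^ k * \<bar>\<phi> (n k) (h k)\<bar>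
    then (\<lambda>x. f x + (1/3) ^ k * h k x) else (\<lambda>x. f x + (-((1/3) ^ k)) * h k x))" for k f
  define F where "F = rec_nat (\<lambda>x. 0) step"
  have F_simps: "F 0 = (\<lambda>x. 0)" "\<And>k. F (Suc k) = step k (F k)" by (simp_all add: F_def)
  have F: "F k \<in> ?C" for k
  proof (induction k)
    case (Suc k)
    show ?case
      unfolding F_simps step_def
      by (split if_split) (intro conjI impI continuous_functions_add continuous_functions_scale Suc h)
  qed (simp add: F_simps continuous_functions_zero)
  have incr: "\<bar>F (Suc k) x - F k x\<bar> \<le> (1/3) ^ k" for k x
    using h(2)[of k x] by (auto simp: F_simps step_def abs_mult mult_left_le)
  have large: "\<bar>\<phi> (n k) (F (Suc k))\<bar> \<ge> (1/3) ^ k * \<bar>\<phi> (n k) (h k)\<bar>" for k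
  proof (cases "\<bar>\<phi> (n k) (\<lambda>x. F k x + (1/3) ^ k * h k x)\<bar> \<ge> (1/3) ^ k * \<bar>\<phi> (n k) (h k)\<bar>")
    case False
    then have "F (Suc k) = (\<lambda>x. F k x + (-((1/3) ^ k)) * h k x)" by (simp only: F_simps step_def if_False)
    moreover have "(1/3) ^ k * \<bar>\<phi> (n k) (h k)\<bar> = \<bar>(1/3) ^ k * \<phi> (n k) (h k)\<bar>" by (simp add: abs_mult)
    ultimately show ?thesis using False by (simp only: lin[OF F h(1)])
  qed (simp add: F_simps step_def)
  have "\<exists>l. \<forall>k. \<bar>l - F k x\<bar> \<le> 3/2 * (1/3) ^ k" for x
    using geometric_increments_limit[of "\<lambda>k. F k x"] incr by metis
  then obtain f where f: "\<And>x k. \<bar>f x - F k x\<bar> \<le> 3/2 * (1/3) ^ k" by metis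
  have "(\<lambda>k. 3/2 * (1/3::real) ^ k) \<longlonglongrightarrow> 3/2 * 0"
    by (intro tendsto_intros LIMSEQ_power_zero) auto
  then have fC: "f \<in> ?C"
    using continuous_functions_uniform_limit[of F X f, OF F f] by simp
  obtain B where B: "\<And>m. \<bar>\<phi> m f\<bar> \<le> B" using bd[OF fC] by (auto simp: bounded_real)
  \<comment> \<open>Step \<open>k\<close> secures three quarters of
    \<open>(1/3) ^ k * ?d (n k)\<close>, while the tail after \<open>F (Suc k)\<close> can destroy
    only one half. A quarter remains.\<close>
  have bound: "(4/3) ^ k / 4 \<le> B" for k
  proof -
    let ?g = "\<lambda>x. f x + (-1) * F (Suc k) x"
    have "?g \<in> ?C" by (intro continuous_functions_add continuous_functions_scale fC F)
    moreover have "\<bar>?g x\<bar> \<le> 1/2 * (1/3) ^ k" for x using f[of x "Suc k"] by simp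
    ultimately have "\<bar>\<phi> (n k) ?g\<bar> \<le> ?d (n k) * (1/2 * (1/3) ^ k)"
      by (rule abs_le_dual_norm_sup_norm[OF X \<phi>])
    then have "\<bar>\<phi> (n k) f - \<phi> (n k) (F (Suc k))\<bar> \<le> 1/2 * ((1/3) ^ k * ?d (n k))"
      unfolding lin[OF fC F] by (simp add: algebra_simps)
    moreover have "3/4 * ((1/3) ^ k * ?d (n k)) \<le> (1/3) ^ k * \<bar>\<phi> (n k) (h k)\<bar>"
      using mult_left_mono[OF less_imp_le[OF h(3)[of k]], of "(1/3) ^ k"]
      by (simp only: mult.left_commute[of "3/4"]) simp
    moreover have "(1/3) ^ k * 4 ^ k \<le> (1/3) ^ k * ?d (n k)"
      using n[of k] by (intro mult_left_mono) auto
    moreover have "(1/3) ^ k * 4 ^ k = (4/3 :: real) ^ k" by (simp flip: power_mult_distrib)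
    ultimately show ?thesis using large[of k] B[of "n k"] by linarith
  qed
  obtain k where "4 * B < (4/3) ^ k" using real_arch_pow[of "4/3" "4 * B"] by auto
  then show False using bound[of k] by simp
qed

section \<open>Limits along filters\<close>

text \<open>Compactness of \<open>{-B..B}\<close> gives a cluster point. An ultrafilter that does
  not eventually stay in an open \<open>V\<close> eventually avoids it, so the cluster point is a
  limit.\<close>

lemma ultrafilter_convergent:
  assumes "H \<in> ultrafilters_nat" "bounded (range (s :: nat \<Rightarrow> real))"
  shows "\<exists>l. (s \<longlongrightarrow> l) H"
proof -
  obtain B where B: "\<And>n. \<bar>s n\<bar> \<le> B" using assms(2) by (auto simp: bounded_real)
  have "H \<noteq> bot" using assms(1) by (simp add: ultrafilters_nat_def)
  then have "filtermap s H \<noteq> bot" by (simp add: filtermap_bot_iff)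
  moreover have "eventually (\<lambda>x. x \<in> {-B..B}) (filtermap s H)"
    using B by (simp add: eventually_filtermap abs_le_iff minus_le_iff)
  ultimately obtain l where l: "inf (nhds l) (filtermap s H) \<noteq> bot"
    using compact_filter[of "{-B..B}"] by auto
  have "(s \<longlongrightarrow> l) H"
  proof (rule topological_tendstoI, rule ccontr)
    fix V assume V: "open V" "l \<in> V" "\<not> eventually (\<lambda>n. s n \<in> V) H"
    then have "eventually (\<lambda>y. y \<notin> V) (filtermap s H)"
      using assms(1) by (auto simp: ultrafilters_nat_def eventually_filtermap)
    moreover have "eventually (\<lambda>y. y \<in> V) (nhds l)" using V by (simp add: eventually_nhds_in_open)
    ultimately have "eventually (\<lambda>y. False) (inf (nhds l) (filtermap s H))"
      unfolding eventually_inf by blast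
    then show False using l trivial_limit_def by blast
  qed
  then show ?thesis ..
qed

text \<open>\<open>H\<close> does the work of a free ultrafilter. By Tychonoff the evaluations
  \<open>p n\<close> have a cluster point \<open>\<Phi>\<close> in a product indexed by all
  sequences; \<open>H\<close> pulls back its neighbourhoods along \<open>p\<close> and adds the
  tails of the natural numbers.\<close>

lemma bounded_sequences_convergent_filter:
  obtains H :: "nat filter" where "H \<noteq> bot" "H \<le> sequentially"
    "\<And>s :: nat \<Rightarrow> real. bounded (range s) \<Longrightarrow> \<exists>l. (s \<longlongrightarrow> l) H"
proof -
  have "\<exists>B\<ge>0. bounded (range s) \<longrightarrow> (\<forall>n. \<bar>s n\<bar> \<le> B)" for s :: "nat \<Rightarrow> real"
    by (metis abs_ge_zero bounded_real dual_order.trans order_refl rangeI)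
  then obtain B where B: "\<And>s :: nat \<Rightarrow> real. 0 \<le> B s"
      "\<And>s n. bounded (range s) \<Longrightarrow> \<bar>s n\<bar> \<le> B s" by metis
  \<comment> \<open>The default 0 for unbounded sequences keeps \<open>p n\<close> inside the
    compact box \<open>?K\<close>.\<close>
  define p where "p n s = (if bounded (range s) then s n else 0)" for n :: nat and s :: "nat \<Rightarrow> real"
  let ?K = "\<Pi>\<^sub>E s\<in>UNIV. {- B s..B s}"
  have "compact ?K"
    using compactin_PiE[of "\<lambda>_. euclideanreal" UNIV "\<lambda>s. {- B s..B s}"]
    by (simp add: euclidean_product_topology compactin_euclidean_iff)
  moreover have "p n \<in> ?K" for n
    using B by (auto simp: p_def abs_le_iff minus_le_iff)
  then have "eventually (\<lambda>y. y \<in> ?K) (filtermap p sequentially)"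
    by (simp add: eventually_filtermap)
  moreover have "filtermap p sequentially \<noteq> bot" by (simp add: filtermap_bot_iff)
  ultimately obtain \<Phi> where \<Phi>: "inf (nhds \<Phi>) (filtermap p sequentially) \<noteq> bot"
    using compact_filter[of ?K] by blast
  define H where "H = inf (filtercomap p (nhds \<Phi>)) sequentially"
  have "H \<noteq> bot"
  proof
    assume "H = bot"
    then obtain P Q where P: "eventually P (nhds \<Phi>)" and Q: "eventually Q sequentially"
        and PQ: "\<And>n. \<not> (P (p n) \<and> Q n)"
      unfolding H_def trivial_limit_def eventually_inf eventually_filtercomap by metis
    have "eventually (\<lambda>y. \<not> P y) (filtermap p sequentially)"
      using Q PQ by (auto simp: eventually_filtermap elim: eventually_mono)
    then have "eventually (\<lambda>y. False) (inf (nhds \<Phi>) (filtermap p sequentially))"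
      using P unfolding eventually_inf by blast
    then show False using \<Phi> trivial_limit_def by blast
  qed
  moreover have "\<exists>l. (s \<longlongrightarrow> l) H" if "bounded (range s)" for s :: "nat \<Rightarrow> real"
  proof -
    have "filterlim p (nhds \<Phi>) H"
      unfolding H_def by (rule filterlim_mono[OF filterlim_filtercomap]) auto
    then have "((\<lambda>n. p n s) \<longlongrightarrow> \<Phi> s) H"
      by (rule continuous_on_tendsto_compose[OF continuous_on_product_coordinates]) simp_all
    then show ?thesis using that by (auto simp: p_def)
  qed
  ultimately show thesis using that by (auto simp: H_def)
qed

section \<open>Finitely supported measures and the Grothendieck property\<close>

text \<open>
  A gliding hump: \<open>g\<close> copies the signs of \<open>a (n k)\<close> on the part of its support that is disjoint from
  the supports of the preceding \<open>a (n j)\<close>, where \<open>a (n k)\<close> has almost all of its mass.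
\<close>

lemma schur_finite_support:
  fixes a :: "nat \<Rightarrow> 'a \<Rightarrow> real"
  assumes fin: "\<And>n. finite {x. a n x \<noteq> 0}"
    and lim: "\<And>g. (\<And>x. \<bar>g x\<bar> \<le> 1) \<Longrightarrow> (\<lambda>n. \<Sum>x | a n x \<noteq> 0. a n x * g x) \<longlonglongrightarrow> 0"
    and e: "0 < e"
  shows "\<exists>n\<ge>m. (\<Sum>x | a n x \<noteq> 0. \<bar>a n x\<bar>) < e"
proof (rule ccontr)
  let ?supp = "\<lambda>n. {x. a n x \<noteq> 0}"
  assume "\<not> ?thesis"
  then have large: "e \<le> (\<Sum>x\<in>?supp n. \<bar>a n x\<bar>)" if "m \<le> n" for n
    using that by (meson not_le)
  \<comment> \<open>Testing against the indicator of one point shows that no fixed finite set keeps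
    any mass in the limit.\<close>
  have coord: "(\<lambda>n. \<bar>a n y\<bar>) \<longlonglongrightarrow> 0" for y
  proof -
    have "(\<Sum>x\<in>?supp n. a n x * (if x = y then 1 else 0)) = a n y" (is "?l = _") for n
    proof -
      have "?l = (\<Sum>x\<in>?supp n. if x = y then a n y else 0)" by (rule sum.cong) simp_all
      then show ?thesis using fin[of n] by simp
    qed
    then have "(\<lambda>n. a n y) \<longlonglongrightarrow> 0" using lim[of "\<lambda>x. if x = y then 1 else 0"] by simp
    then show ?thesis by (rule tendsto_rabs_zero)
  qed
  have "\<exists>n. m \<le> n \<and> k < n \<and> (\<Sum>x\<in>T. \<bar>a n x\<bar>) < e / 4" if "finite T" for T k
  proof -
    have "(\<lambda>n. \<Sum>x\<in>T. \<bar>a n x\<bar>) \<longlonglongrightarrow> 0" by (intro tendsto_null_sum coord)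
    then have "eventually (\<lambda>n. (\<Sum>x\<in>T. \<bar>a n x\<bar>) < e / 4) sequentially"
      using e by (intro order_tendstoD) auto
    moreover have "eventually (\<lambda>n. m \<le> n \<and> k < n) sequentially"
      using eventually_ge_at_top[of m] eventually_gt_at_top[of k] by eventually_elim simp
    ultimately have "eventually (\<lambda>n. m \<le> n \<and> k < n \<and> (\<Sum>x\<in>T. \<bar>a n x\<bar>) < e / 4) sequentially"
      by eventually_elim simp
    then show ?thesis using eventually_happens by force
  qed
  then have "\<exists>n. m \<le> n \<and> k < n \<and> (\<Sum>x\<in>(\<Union>j\<le>k. ?supp j). \<bar>a n x\<bar>) < e / 4" for k
    using fin by simp
  then obtain s where s: "\<And>k. m \<le> s k" "\<And>k. k < s k"
      "\<And>k. (\<Sum>x\<in>(\<Union>j\<le>k. ?supp j). \<bar>a (s k) x\<bar>) < e / 4" by metis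
  \<comment> \<open>Since \<open>n (Suc k) = s (n k)\<close>, the supports of all \<open>a j\<close>
    with \<open>j \<le> n k\<close> together carry less than \<open>e / 4\<close> of the mass of
    \<open>a (n (Suc k))\<close>.\<close>
  define n where "n k = (s ^^ Suc k) 0" for k
  have n_Suc: "n (Suc k) = s (n k)" for k by (simp add: n_def)
  have "strict_mono n" by (rule strict_mono_Suc_iff[THEN iffD2]) (simp add: n_Suc s)
  \<comment> \<open>A point gets the sign given by the first selected measure that charges
    it.\<close>
  define g where "g x = (if \<exists>k. a (n k) x \<noteq> 0 then sgn (a (n (LEAST k. a (n k) x \<noteq> 0)) x) else 0)" for x
  have g1: "\<bar>g x\<bar> \<le> 1" for x by (simp add: g_def abs_sgn_eq)
  have "e / 2 \<le> (\<Sum>x\<in>?supp (n (Suc k)). a (n (Suc k)) x * g x)" for k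
  proof -
    let ?b = "a (n (Suc k))" and ?T = "\<Union>j\<le>n k. ?supp j"
    have T: "finite ?T" using fin by blast
    \<comment> \<open>On \<open>?T\<close> the sign of \<open>g\<close> may be wrong. This costs at
      most twice the mass there, less than \<open>e / 2\<close> in total, out of a mass of at least
      \<open>e\<close>.\<close>
    have "\<bar>?b x\<bar> - 2 * (if x \<in> ?T then \<bar>?b x\<bar> else 0) \<le> ?b x * g x" for x
    proof (cases "x \<in> ?T \<or> ?b x = 0")
      case True
      have "\<bar>?b x * g x\<bar> \<le> \<bar>?b x\<bar>" using g1[of x] by (simp add: abs_mult mult_left_le)
      then show ?thesis using True by (auto simp: abs_le_iff)
    next
      case False
      then have "a (n j) x = 0" if "j \<le> k" for j
        using strict_mono_leD[OF \<open>strict_mono n\<close> that] by auto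
      then have "(LEAST j. a (n j) x \<noteq> 0) = Suc k"
        using False by (intro Least_equality) (auto simp: not_less_eq_eq[symmetric])
      then have "g x = sgn (?b x)" using False by (auto simp: g_def)
      then show ?thesis using False by (simp add: abs_sgn mult.commute)
    qed
    then have "(\<Sum>x\<in>?supp (n (Suc k)). \<bar>?b x\<bar> - 2 * (if x \<in> ?T then \<bar>?b x\<bar> else 0))
        \<le> (\<Sum>x\<in>?supp (n (Suc k)). ?b x * g x)" by (intro sum_mono) auto
    moreover have "(\<Sum>x\<in>?supp (n (Suc k)). \<bar>?b x\<bar> - 2 * (if x \<in> ?T then \<bar>?b x\<bar> else 0)) =
        (\<Sum>x\<in>?supp (n (Suc k)). \<bar>?b x\<bar>) - 2 * (\<Sum>x\<in>?supp (n (Suc k)) \<inter> ?T. \<bar>?b x\<bar>)"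
      unfolding sum_subtractf sum_distrib_left[symmetric]
      using fin[of "n (Suc k)"] by (simp only: sum.inter_restrict)
    moreover have "(\<Sum>x\<in>?supp (n (Suc k)) \<inter> ?T. \<bar>?b x\<bar>) \<le> (\<Sum>x\<in>?T. \<bar>?b x\<bar>)"
      using T by (intro sum_mono2) auto
    moreover have "(\<Sum>x\<in>?T. \<bar>?b x\<bar>) < e / 4" using s(3)[of "n k"] by (simp only: n_Suc)
    moreover have "e \<le> (\<Sum>x\<in>?supp (n (Suc k)). \<bar>?b x\<bar>)" using large s(1) by (simp add: n_Suc)
    ultimately show ?thesis by linarith
  qed
  moreover have "(\<lambda>k. \<Sum>x\<in>?supp (n (Suc k)). a (n (Suc k)) x * g x) \<longlonglongrightarrow> 0"
    using LIMSEQ_Suc[OF LIMSEQ_subseq_LIMSEQ[OF lim[OF g1] \<open>strict_mono n\<close>]] by (simp add: o_def)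
  ultimately have "e / 2 \<le> 0" by (intro LIMSEQ_le_const) auto
  then show False using e by simp
qed

section \<open>Weak topologies and finitely supported functionals\<close>

lemma weak_topology_limitin_mem: "limitin (weak_topology E N) f l F \<Longrightarrow> l \<in> E"
  using limitin_topspace by (fastforce simp: weak_topology_def topspace_pullback_topology)

lemma weak_topology_limitin:
  assumes lim: "limitin (weak_topology E N) f l F" and \<Phi>: "\<Phi> \<in> dual_space E N"
  shows "((\<lambda>n. \<Phi> (f n)) \<longlongrightarrow> \<Phi> l) F"
proof -
  let ?e = "\<lambda>f. \<lambda>\<phi>\<in>dual_space E N. \<phi> f"
  have "continuous_map (weak_topology E N) (powertop_real (dual_space E N)) (id \<circ> ?e)"
    unfolding weak_topology_def by (rule continuous_map_pullback) simp
  then have "limitin (powertop_real (dual_space E N)) (?e \<circ> f) (?e l) F"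
    using continuous_map_limit[OF _ lim] by simp
  then show ?thesis using \<Phi> by (simp add: limitin_componentwise)
qed

lemma dual_space_add:
  assumes "\<psi> \<in> dual_space E N" "\<psi>' \<in> dual_space E N"
  shows "(\<lambda>f. \<psi> f + \<psi>' f) \<in> dual_space E N"
proof -
  obtain c where c: "\<forall>f\<in>E. \<bar>\<psi> f\<bar> \<le> c * N f" using assms(1) unfolding dual_space_def by blast
  obtain d where d: "\<forall>f\<in>E. \<bar>\<psi>' f\<bar> \<le> d * N f" using assms(2) unfolding dual_space_def by blast
  have "\<bar>\<psi> f + \<psi>' f\<bar> \<le> (c + d) * N f" if "f \<in> E" for f
    using c[THEN bspec, OF that] d[THEN bspec, OF that] by (simp add: algebra_simps)
  moreover have "linear_functional_on E (\<lambda>f. \<psi> f + \<psi>' f)"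
    using assms by (simp add: dual_space_def linear_functional_on_def algebra_simps)
  ultimately show ?thesis using assms unfolding dual_space_def by auto
qed

lemma dual_space_scale:
  assumes "\<psi> \<in> dual_space E N"
  shows "(\<lambda>f. c * \<psi> f) \<in> dual_space E N"
proof -
  obtain b where b: "\<forall>f\<in>E. \<bar>\<psi> f\<bar> \<le> b * N f" using assms unfolding dual_space_def by blast
  have "\<bar>c * \<psi> f\<bar> \<le> (\<bar>c\<bar> * b) * N f" if "f \<in> E" for f
    using mult_left_mono[OF b[THEN bspec, OF that] abs_ge_zero[of c]] by (simp add: abs_mult mult.assoc)
  moreover have "linear_functional_on E (\<lambda>f. c * \<psi> f)"
    using assms by (simp add: dual_space_def linear_functional_on_def algebra_simps)
  ultimately show ?thesis using assms unfolding dual_space_def by auto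
qed

text \<open>The total mass of \<open>a\<close> serves as the constant. For an infinite support all
  these sums are 0 by convention.\<close>

lemma finite_support_dual_space:
  assumes X: "compact_space X"
  shows "(\<lambda>f. if f \<in> continuous_functions X then \<Sum>x | a x \<noteq> 0. a x * f x else 0)
    \<in> dual_space (continuous_functions X) sup_norm" (is "?\<phi> \<in> dual_space ?C sup_norm")
proof -
  have "linear_functional_on ?C ?\<phi>"
    unfolding linear_functional_on_def
    by (simp add: continuous_functions_add continuous_functions_scale distrib_left
        mult.left_commute sum.distrib sum_distrib_left)
  moreover have "\<bar>?\<phi> f\<bar> \<le> (\<Sum>x | a x \<noteq> 0. \<bar>a x\<bar>) * sup_norm f" if "f \<in> ?C" for f
  proof -
    have "\<bar>?\<phi> f\<bar> \<le> (\<Sum>x | a x \<noteq> 0. \<bar>a x * f x\<bar>)" using that by (simp add: sum_abs)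
    also have "\<dots> \<le> (\<Sum>x | a x \<noteq> 0. \<bar>a x\<bar> * sup_norm f)"
      using continuous_functions_le_sup_norm[OF X that]
      by (intro sum_mono) (simp add: abs_mult mult_left_mono)
    finally show ?thesis by (simp add: sum_distrib_right)
  qed
  ultimately show ?thesis unfolding dual_space_def by auto
qed

text \<open>
  The bidual functional is a limit of evaluations at functions \<open>f m\<close> interpolating \<open>g\<close> on the supports
  of \<open>a 0, \<dots>, a m\<close>.
\<close>

lemma grothendieck_finite_support_limit:
  fixes a :: "nat \<Rightarrow> 'a \<Rightarrow> real"
  assumes X: "compact_space X" "Hausdorff_space X"
    and groth: "grothendieck_property (continuous_functions X) sup_norm"
    and a: "\<And>n. finite {x. a n x \<noteq> 0}" "\<And>n. {x. a n x \<noteq> 0} \<subseteq> topspace X"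
    and lim: "\<And>f. f \<in> continuous_functions X \<Longrightarrow> (\<lambda>n. \<Sum>x | a n x \<noteq> 0. a n x * f x) \<longlonglongrightarrow> 0"
    and g: "\<And>x. \<bar>g x\<bar> \<le> 1"
  shows "(\<lambda>n. \<Sum>x | a n x \<noteq> 0. a n x * g x) \<longlonglongrightarrow> 0"
proof -
  let ?C = "continuous_functions X"
  let ?D = "dual_space ?C sup_norm" and ?d = "dual_norm ?C sup_norm"
  define \<phi> where "\<phi> n f = (if f \<in> ?C then \<Sum>x | a n x \<noteq> 0. a n x * f x else 0)" for n f
  have \<phi>D: "\<phi> n \<in> ?D" for n unfolding \<phi>_def by (rule finite_support_dual_space[OF X(1)])
  have "limitin (weak_star_topology ?C sup_norm) \<phi> (\<lambda>f. 0) sequentially"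
  proof -
    have "(\<lambda>f. 0) \<in> ?D"
      by (auto simp: dual_space_def linear_functional_on_def intro: exI[of _ 0])
    moreover have "(\<lambda>n. \<phi> n f) \<longlonglongrightarrow> 0" for f
      using lim[of f] by (cases "f \<in> ?C") (simp_all add: \<phi>_def)
    ultimately show ?thesis
      using \<phi>D by (simp add: weak_star_topology_def limitin_subtopology limitin_componentwise)
  qed
  then obtain l where l: "limitin (weak_topology ?D ?d) \<phi> l sequentially"
    using groth \<phi>D unfolding grothendieck_property_def by blast
  have bidual: "\<Phi> \<in> dual_space ?D ?d"
    if "linear_functional_on ?D \<Phi>" "\<And>\<psi>. \<psi> \<in> ?D \<Longrightarrow> \<bar>\<Phi> \<psi>\<bar> \<le> c * ?d \<psi>" "\<And>\<psi>. \<psi> \<notin> ?D \<Longrightarrow> \<Phi> \<psi> = 0"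
    for \<Phi> c
    using that by (auto simp: dual_space_def)
  have lD: "l \<in> ?D" using l by (rule weak_topology_limitin_mem)
  \<comment> \<open>The Grothendieck property yields some weak limit. Evaluations at members of
    \<open>?C\<close> are bidual functionals, so this limit must agree with the weak-star limit
    0.\<close>
  have "l f = 0" for f
  proof (cases "f \<in> ?C")
    case True
    let ?\<Phi> = "\<lambda>\<psi>. if \<psi> \<in> ?D then \<psi> f else 0"
    have "?\<Phi> \<in> dual_space ?D ?d"
    proof (rule bidual)
      show "linear_functional_on ?D ?\<Phi>"
        by (simp add: linear_functional_on_def dual_space_add dual_space_scale)
      show "\<bar>?\<Phi> \<psi>\<bar> \<le> sup_norm f * ?d \<psi>" if "\<psi> \<in> ?D" for \<psi>
        using abs_le_dual_norm_sup_norm[OF X(1) that True continuous_functions_le_sup_norm[OF X(1) True]]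
          that by (simp add: mult.commute)
    qed simp
    then have "(\<lambda>n. ?\<Phi> (\<phi> n)) \<longlonglongrightarrow> ?\<Phi> l" by (rule weak_topology_limitin[OF l])
    then have "(\<lambda>n. \<phi> n f) \<longlonglongrightarrow> l f" by (simp only: \<phi>D lD if_True)
    moreover have "(\<lambda>n. \<phi> n f) \<longlonglongrightarrow> 0" using lim[OF True] True by (simp add: \<phi>_def)
    ultimately show ?thesis by (rule LIMSEQ_unique)
  next
    case False
    then show ?thesis using lD by (simp add: dual_space_def)
  qed
  then have l0: "l = (\<lambda>f. 0)" by blast
  have "\<exists>f\<in>?C. (\<forall>x\<in>(\<Union>n\<le>m. {x. a n x \<noteq> 0}). f x = g x) \<and> (\<forall>x. \<bar>f x\<bar> \<le> 1)" for m
    by (rule continuous_functions_interpolate[OF X, of "\<Union>n\<le>m. {x. a n x \<noteq> 0}" g 1])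
       (use a g in auto)
  then obtain f where f: "\<And>m. f m \<in> ?C" "\<And>m x. \<bar>f m x\<bar> \<le> 1"
      "\<And>m x. x \<in> (\<Union>n\<le>m. {x. a n x \<noteq> 0}) \<Longrightarrow> f m x = g x" by metis
  \<comment> \<open>The sequences \<open>\<psi> (f m)\<close> are only known to be bounded. One
    filter along which all of them converge makes the limit linear in \<open>\<psi>\<close>.\<close>
  obtain H :: "nat filter" where H: "H \<noteq> bot" "H \<le> sequentially"
      "\<And>s :: nat \<Rightarrow> real. bounded (range s) \<Longrightarrow> \<exists>l. (s \<longlongrightarrow> l) H"
    using bounded_sequences_convergent_filter by blast
  have "\<exists>r. ((\<lambda>m. \<psi> (f m)) \<longlongrightarrow> r) H" if "\<psi> \<in> ?D" for \<psi>
    using abs_le_dual_norm_sup_norm[OF X(1) that f(1) f(2)] by (intro H(3)) (auto simp: bounded_real)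
  then obtain L where L: "\<And>\<psi>. \<psi> \<in> ?D \<Longrightarrow> ((\<lambda>m. \<psi> (f m)) \<longlongrightarrow> L \<psi>) H" by metis
  define \<Phi> where "\<Phi> \<psi> = (if \<psi> \<in> ?D then L \<psi> else 0)" for \<psi>
  have "\<Phi> \<in> dual_space ?D ?d"
  proof (rule bidual)
    show "linear_functional_on ?D \<Phi>"
      unfolding linear_functional_on_def
    proof (intro conjI ballI allI)
      show "\<Phi> (\<lambda>f. \<psi> f + \<psi>' f) = \<Phi> \<psi> + \<Phi> \<psi>'" if "\<psi> \<in> ?D" "\<psi>' \<in> ?D" for \<psi> \<psi>'
        using tendsto_unique[OF H(1) L[OF dual_space_add[OF that]] tendsto_add[OF L[OF that(1)] L[OF that(2)]]]
        by (simp add: \<Phi>_def that dual_space_add)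
      show "\<Phi> (\<lambda>f. c * \<psi> f) = c * \<Phi> \<psi>" if "\<psi> \<in> ?D" for \<psi> c
        using tendsto_unique[OF H(1) L[OF dual_space_scale[OF that]] tendsto_mult_left[OF L[OF that]]]
        by (simp add: \<Phi>_def that dual_space_scale)
    qed
    show "\<bar>\<Phi> \<psi>\<bar> \<le> 1 * ?d \<psi>" if "\<psi> \<in> ?D" for \<psi>
      using tendsto_upperbound[OF tendsto_rabs[OF L[OF that]] _ H(1), of "?d \<psi>"]
        abs_le_dual_norm_sup_norm[OF X(1) that f(1) f(2)] that by (simp add: \<Phi>_def)
  qed (simp add: \<Phi>_def)
  then have "(\<lambda>n. \<Phi> (\<phi> n)) \<longlonglongrightarrow> \<Phi> l" by (rule weak_topology_limitin[OF l])
  moreover have "\<Phi> l = 0"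
    using tendsto_unique[OF H(1) L[OF lD], of 0] lD by (simp add: \<Phi>_def l0)
  moreover have "\<Phi> (\<phi> n) = (\<Sum>x | a n x \<noteq> 0. a n x * g x)" for n
  proof -
    \<comment> \<open>From \<open>m = n\<close> on, \<open>f m\<close> equals \<open>g\<close> on
      the support of \<open>a n\<close>, so the sequence is eventually constant; \<open>H\<close> is
      finer than \<open>sequentially\<close> and sees this.\<close>
    have "eventually (\<lambda>m. n \<le> m) H" using H(2) eventually_ge_at_top[of n] by (rule filter_leD)
    then have "eventually (\<lambda>m. \<phi> n (f m) = (\<Sum>x | a n x \<noteq> 0. a n x * g x)) H"
    proof eventually_elim
      case (elim m)
      then show ?case using f(1) by (simp add: \<phi>_def) (intro sum.cong, auto intro!: f(3))
    qed
    then have "((\<lambda>m. \<phi> n (f m)) \<longlongrightarrow> (\<Sum>x | a n x \<noteq> 0. a n x * g x)) H"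
      by (rule tendsto_eventually)
    then show ?thesis using tendsto_unique[OF H(1) L[OF \<phi>D]] \<phi>D by (simp add: \<Phi>_def)
  qed
  ultimately show ?thesis by simp
qed

section \<open>Quotients onto spaces of null sequences\<close>

lemma quotient_map_coordinates:
  assumes X: "compact_space X" "Hausdorff_space X"
    and q: "linear_quotient_map (pointwise_topology (continuous_functions X))
          (pointwise_topology (F :: (nat \<Rightarrow> real) set)) q"
  obtains a :: "nat \<Rightarrow> 'a \<Rightarrow> real" where "\<And>n. finite {x. a n x \<noteq> 0}" "\<And>n. {x. a n x \<noteq> 0} \<subseteq> topspace X"
    "\<And>n f. f \<in> continuous_functions X \<Longrightarrow> q f n = (\<Sum>x | a n x \<noteq> 0. a n x * f x)"
proof -
  let ?C = "continuous_functions X"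
  have "linear_functional_on ?C (\<lambda>f. q f n)" for n
    using q by (simp add: linear_quotient_map_def linear_map_on_def linear_functional_on_def)
  moreover have "continuous_map (pointwise_topology ?C) euclideanreal (\<lambda>f. q f n)" for n
    using q by (simp add: linear_quotient_map_def pointwise_topology_def[of F]
        continuous_map_in_subtopology continuous_map_componentwise_UNIV)
  ultimately have "\<exists>a. finite {x. a x \<noteq> 0} \<and> {x. a x \<noteq> 0} \<subseteq> topspace X \<and>
      (\<forall>f\<in>?C. q f n = (\<Sum>x | a x \<noteq> 0. a x * f x))" for n
    using pointwise_continuous_functional_finite_support[OF X, of "\<lambda>f. q f n"] by metis
  then have "\<forall>n. \<exists>a. finite {x. a x \<noteq> 0} \<and> {x. a x \<noteq> 0} \<subseteq> topspace X \<and>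
      (\<forall>f\<in>?C. q f n = (\<Sum>x | a x \<noteq> 0. a x * f x))" ..
  from choice[OF this] obtain a where "\<And>n. finite {x. a n x \<noteq> 0} \<and> {x. a n x \<noteq> 0} \<subseteq> topspace X \<and>
      (\<forall>f\<in>?C. q f n = (\<Sum>x | a n x \<noteq> 0. a n x * f x))" by blast
  then show thesis by (intro that[of a]) blast+
qed

text \<open>One argument for \<open>c_zero\<close> and every \<open>l_space p\<close>, with
  \<open>rich\<close> isolating what the target must contain. If the measures \<open>a (s k)\<close>
  have mass below \<open>(1/4) ^ k\<close> and \<open>q f\<close> has the value
  \<open>(1/2) ^ k\<close> at \<open>s k\<close>, then \<open>sup_norm f\<close> is at least
  \<open>2 ^ k\<close> for every \<open>k\<close>.\<close>

lemma grothendieck_no_null_sequence_quotient: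
  fixes F :: "(nat \<Rightarrow> real) set"
  assumes X: "compact_space X" "Hausdorff_space X"
    and groth: "grothendieck_property (continuous_functions X) sup_norm"
    and null: "F \<subseteq> c_zero"
    and rich: "\<And>s. strict_mono s \<Longrightarrow> \<exists>y\<in>F. \<forall>k. y (s k) = (1/2) ^ k"
  shows "\<not> has_quotient_isomorphic (pointwise_topology (continuous_functions X)) (pointwise_topology F)"
proof
  let ?C = "continuous_functions X"
  assume "has_quotient_isomorphic (pointwise_topology ?C) (pointwise_topology F)"
  then obtain q where q: "linear_quotient_map (pointwise_topology ?C) (pointwise_topology F) q"
    by (auto simp: has_quotient_isomorphic_def)
  then have im: "q ` ?C = F" by (simp add: linear_quotient_map_def)
  obtain a where a: "\<And>n. finite {x. a n x \<noteq> 0}" "\<And>n. {x. a n x \<noteq> 0} \<subseteq> topspace X"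
    and q_eq: "\<And>n f. f \<in> ?C \<Longrightarrow> q f n = (\<Sum>x | a n x \<noteq> 0. a n x * f x)"
    using quotient_map_coordinates[OF X q] by blast
  have "(\<lambda>n. \<Sum>x | a n x \<noteq> 0. a n x * f x) \<longlonglongrightarrow> 0" if "f \<in> ?C" for f
  proof -
    have "q f \<in> c_zero" using im null that by blast
    then show ?thesis by (simp add: c_zero_def q_eq[OF that, symmetric])
  qed
  then have "(\<lambda>n. \<Sum>x | a n x \<noteq> 0. a n x * g x) \<longlonglongrightarrow> 0" if "\<And>x. \<bar>g x\<bar> \<le> 1" for g
    using that by (rule grothendieck_finite_support_limit[OF X groth a])
  note small = schur_finite_support[of a, OF a(1) this]
  have "\<exists>s. \<forall>k. (\<Sum>x | a (s k) x \<noteq> 0. \<bar>a (s k) x\<bar>) < (1/4) ^ k \<and> s k < s (Suc k)"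
  proof (rule dependent_nat_choice)
    show "\<exists>n. (\<Sum>x | a n x \<noteq> 0. \<bar>a n x\<bar>) < (1/4) ^ 0" using small[of 1 0] by simp
    show "\<exists>n. (\<Sum>x | a n x \<noteq> 0. \<bar>a n x\<bar>) < (1/4) ^ Suc k \<and> m < n" for m k
      using small[of "(1/4) ^ Suc k" "Suc m"] by (auto simp: Suc_le_eq)
  qed
  then obtain s where s: "\<And>k. (\<Sum>x | a (s k) x \<noteq> 0. \<bar>a (s k) x\<bar>) < (1/4) ^ k"
    and "strict_mono s" by (auto simp: strict_mono_Suc_iff)
  then obtain f where f: "f \<in> ?C" "\<And>k. q f (s k) = (1/2) ^ k" using rich im by (metis imageE)
  have "2 ^ k \<le> sup_norm f" for k
  proof -
    have "(1/2) ^ k \<le> \<bar>\<Sum>x | a (s k) x \<noteq> 0. a (s k) x * f x\<bar>"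
      using q_eq[OF f(1), of "s k"] f(2)[of k] by simp
    also have "\<dots> \<le> (\<Sum>x | a (s k) x \<noteq> 0. \<bar>a (s k) x\<bar> * sup_norm f)"
      using continuous_functions_le_sup_norm[OF X(1) f(1)]
      by (intro order_trans[OF sum_abs] sum_mono) (simp add: abs_mult mult_left_mono)
    also have "\<dots> \<le> (1/4) ^ k * sup_norm f"
      unfolding sum_distrib_right[symmetric]
      using s[of k] sup_norm_nonneg[OF X(1) f(1)] by (intro mult_right_mono) auto
    finally have "4 ^ k * (1/2) ^ k \<le> 4 ^ k * ((1/4) ^ k * sup_norm f)" by (rule mult_left_mono) simp
    moreover have "4 ^ k * (1/2) ^ k = (2 :: real) ^ k" "4 ^ k * ((1/4) ^ k :: real) = 1"
      by (simp_all flip: power_mult_distrib)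
    ultimately show ?thesis by (simp only: mult.assoc[symmetric] mult_1)
  qed
  moreover obtain k where "sup_norm f < 2 ^ k" using real_arch_pow[of 2 "sup_norm f"] by auto
  ultimately show False by (meson not_less)
qed

lemma l_space_subset_c_zero:
  assumes "p \<ge> 1"
  shows "l_space p \<subseteq> c_zero"
proof
  fix y assume "y \<in> l_space p"
  then have "(\<lambda>n. \<bar>y n\<bar> powr p) \<longlonglongrightarrow> 0" by (simp add: l_space_def summable_LIMSEQ_zero)
  then have "(\<lambda>n. (\<bar>y n\<bar> powr p) powr (1 / p)) \<longlonglongrightarrow> 0 powr (1 / p)"
    using assms by (intro tendsto_powr2 tendsto_const) (auto)
  then have "(\<lambda>n. \<bar>y n\<bar>) \<longlonglongrightarrow> 0" using assms by (simp add: powr_powr)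
  then show "y \<in> c_zero" by (simp add: c_zero_def tendsto_rabs_zero_iff)
qed

text \<open>The geometric sequence is placed on the range of \<open>s\<close>, with 0 elsewhere. Its
  entries are at most 1, so \<open>p \<ge> 1\<close> bounds their powers by the entries
  themselves.\<close>

lemma l_space_geometric_subsequence:
  assumes "p \<ge> 1" "strict_mono s"
  shows "\<exists>y\<in>l_space p. \<forall>k. y (s k) = (1/2) ^ k"
proof -
  define y where "y n = (if n \<in> range s then (1/2) ^ (inv s n) else 0 :: real)" for n
  have inj: "inj s" using assms(2) by (rule strict_mono_imp_inj_on)
  then have y: "y (s k) = (1/2) ^ k" for k by (simp add: y_def)
  have "summable (\<lambda>k. \<bar>y (s k)\<bar> powr p)"
  proof (rule summable_comparison_test'[of "\<lambda>k. (1/2) ^ k" 0])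
    show "norm (\<bar>y (s k)\<bar> powr p) \<le> (1/2) ^ k" for k
      using powr_mono'[of 1 p "(1/2) ^ k"] assms(1) by (simp add: y power_le_one)
  qed (simp add: summable_geometric)
  then have "summable (\<lambda>n. \<bar>y n\<bar> powr p)"
    using summable_mono_reindex[OF assms(2), of "\<lambda>n. \<bar>y n\<bar> powr p"] by (simp add: y_def)
  then show ?thesis using y by (auto simp: l_space_def)
qed

section \<open>Quotients onto bounded sequences\<close>

lemma topspace_beta_omega [simp]: "topspace beta_omega = ultrafilters_nat"
proof
  show "topspace beta_omega \<subseteq> ultrafilters_nat"
    unfolding beta_omega_def topology_generated_by_topspace by blast
  have "ultrafilters_nat = {F \<in> ultrafilters_nat. eventually (\<lambda>n. n \<in> UNIV) F}" by simp
  then show "ultrafilters_nat \<subseteq> topspace beta_omega"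
    unfolding beta_omega_def topology_generated_by_topspace by blast
qed

lemma openin_beta_omega: "openin beta_omega {F \<in> ultrafilters_nat. eventually (\<lambda>n. n \<in> A) F}"
  unfolding beta_omega_def by (rule topology_generated_by_Basis) blast

text \<open>This map extends \<open>s\<close> to the Stone space. Ultrafilters containing the set
  where \<open>s\<close> is within \<open>e\<close> of its limit along \<open>F\<close> form a
  neighbourhood of \<open>F\<close>; a closed ball is used because limits cannot leave it.\<close>

lemma continuous_map_ultrafilter_limit:
  assumes "bounded (range (s :: nat \<Rightarrow> real))"
  shows "continuous_map beta_omega euclideanreal (\<lambda>F. Lim F s)"
proof -
  have lim: "(s \<longlongrightarrow> Lim F s) F" if F: "F \<in> ultrafilters_nat" for F
    using ultrafilter_convergent[OF F assms] tendsto_Lim F by (auto simp: ultrafilters_nat_def)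
  have "\<exists>W. openin beta_omega W \<and> F \<in> W \<and> W \<subseteq> {F \<in> ultrafilters_nat. Lim F s \<in> V}"
    if V: "open V" "F \<in> ultrafilters_nat" "Lim F s \<in> V" for F V
  proof -
    obtain e where e: "e > 0" "cball (Lim F s) e \<subseteq> V" using V open_contains_cball by blast
    let ?A = "{n. s n \<in> cball (Lim F s) e}"
    let ?W = "{G \<in> ultrafilters_nat. eventually (\<lambda>n. n \<in> ?A) G}"
    have "eventually (\<lambda>n. n \<in> ?A) F"
      using tendstoD[OF lim[OF V(2)] e(1)] by (auto simp: dist_commute elim: eventually_mono)
    moreover have "Lim G s \<in> V" if "G \<in> ?W" for G
    proof -
      have "Lim G s \<in> cball (Lim F s) e"
        using that lim[of G] by (intro Lim_in_closed_set[of _ s G]) (auto simp: ultrafilters_nat_def)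
      then show ?thesis using e by blast
    qed
    ultimately show ?thesis using V openin_beta_omega[of ?A] by (intro exI[of _ ?W]) auto
  qed
  then have "openin beta_omega {F \<in> ultrafilters_nat. Lim F s \<in> V}" if "open V" for V
    using that by (subst openin_subopen) blast
  then show ?thesis by (simp add: continuous_map_def)
qed

text \<open>The embedding sends \<open>F\<close> to the limit \<open>r F\<close> of the
  \<open>\<phi> n\<close> along \<open>F\<close>. By \<open>sep\<close>, evaluation at a single
  function decides whether \<open>A\<close> belongs to \<open>F\<close>; this gives both injectivity
  and continuity of the inverse.\<close>

lemma beta_omega_in_dual_unit_ball:
  assumes X: "compact_space X"
    and \<phi>: "\<And>n::nat. \<phi> n \<in> dual_space (continuous_functions X) sup_norm"
    and bd: "\<And>n. dual_norm (continuous_functions X) sup_norm (\<phi> n) \<le> 1"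
    and sep: "\<And>A. \<exists>f\<in>continuous_functions X. \<exists>c>0. \<forall>n. \<phi> n f = (if n \<in> A then c else 0)"
  shows "contains_copy_of
      (subtopology (weak_star_topology (continuous_functions X) sup_norm)
        (dual_unit_ball (continuous_functions X) sup_norm)) beta_omega"
proof -
  let ?C = "continuous_functions X"
  let ?W = "subtopology (weak_star_topology ?C sup_norm) (dual_unit_ball ?C sup_norm)"
  define r where "r F f = Lim F (\<lambda>n. \<phi> n f)" for F f
  have le: "\<bar>\<phi> n f\<bar> \<le> c" if "f \<in> ?C" "\<And>x. \<bar>f x\<bar> \<le> c" for n f c
  proof -
    have "0 \<le> c" using that(2)[of undefined] by linarith
    then have "dual_norm ?C sup_norm (\<phi> n) * c \<le> 1 * c" using bd by (intro mult_right_mono)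
    then show ?thesis using abs_le_dual_norm_sup_norm[OF X \<phi> that, of n] by linarith
  qed
  have off: "\<phi> n f = 0" if "f \<notin> ?C" for n f using \<phi>[of n] that by (simp add: dual_space_def)
  have bounded: "bounded (range (\<lambda>n. \<phi> n f))" for f
  proof (cases "f \<in> ?C")
    case True
    show ?thesis
      using le[OF True continuous_functions_le_sup_norm[OF X True]] by (auto simp: bounded_real)
  qed (simp add: off)
  have lim: "((\<lambda>n. \<phi> n f) \<longlongrightarrow> r F f) F" if "F \<in> ultrafilters_nat" for F f
    using ultrafilter_convergent[OF that bounded] tendsto_Lim that
    by (auto simp: ultrafilters_nat_def r_def)
  have nontriv: "F \<noteq> bot" if "F \<in> ultrafilters_nat" for F using that by (simp add: ultrafilters_nat_def)
  have r_le: "\<bar>r F f\<bar> \<le> c" if "F \<in> ultrafilters_nat" "f \<in> ?C" "\<And>x. \<bar>f x\<bar> \<le> c" for F f c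
    using tendsto_upperbound[OF tendsto_rabs[OF lim[OF that(1)]] _ nontriv[OF that(1)]] le[OF that(2,3)]
    by simp
  have r_dual: "r F \<in> dual_unit_ball ?C sup_norm" if F: "F \<in> ultrafilters_nat" for F
  proof -
    have lin: "linear_functional_on ?C (\<phi> n)" for n using \<phi>[of n] by (simp add: dual_space_def)
    have "linear_functional_on ?C (r F)"
      unfolding linear_functional_on_def
    proof (intro conjI ballI allI)
      show "r F (\<lambda>x. f x + g x) = r F f + r F g" if "f \<in> ?C" "g \<in> ?C" for f g
        using tendsto_unique[OF nontriv[OF F] lim[OF F, of "\<lambda>x. f x + g x"]
            tendsto_add[OF lim[OF F, of f] lim[OF F, of g], folded linear_functional_add[OF lin that]]] .
      show "r F (\<lambda>x. c * f x) = c * r F f" if "f \<in> ?C" for f c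
        using tendsto_unique[OF nontriv[OF F] lim[OF F, of "\<lambda>x. c * f x"]
            tendsto_mult_left[OF lim[OF F, of f], of c, folded linear_functional_scale[OF lin that]]] .
    qed
    moreover have "\<bar>r F f\<bar> \<le> 1 * sup_norm f" if "f \<in> ?C" for f
      using r_le[OF F that continuous_functions_le_sup_norm[OF X that]] by simp
    moreover have "r F f = 0" if "f \<notin> ?C" for f
      using tendsto_unique[OF nontriv[OF F] lim[OF F, of f], of 0] that by (simp add: off)
    ultimately have "r F \<in> dual_space ?C sup_norm" unfolding dual_space_def by blast
    moreover have "dual_norm ?C sup_norm (r F) \<le> 1" by (rule dual_norm_sup_norm_le[OF X r_le[OF F]])
    ultimately show ?thesis by (simp add: dual_unit_ball_def)
  qed
  have r_sep: "\<exists>f\<in>?C. \<exists>c>0. \<forall>F\<in>ultrafilters_nat. r F f = (if eventually (\<lambda>n. n \<in> A) F then c else 0)" for A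
  proof -
    obtain f c where f: "f \<in> ?C" "c > 0" "\<And>n. \<phi> n f = (if n \<in> A then c else 0)" using sep[of A] by blast
    have "r F f = (if eventually (\<lambda>n. n \<in> A) F then c else 0)" if F: "F \<in> ultrafilters_nat" for F
    proof (cases "eventually (\<lambda>n. n \<in> A) F")
      case True
      then have "eventually (\<lambda>n. \<phi> n f = c) F" by (rule eventually_mono) (simp add: f)
      then show ?thesis
        using tendsto_unique[OF nontriv[OF F] lim[OF F] tendsto_eventually] True by simp
    next
      case False
      then have "eventually (\<lambda>n. n \<notin> A) F" using F by (auto simp: ultrafilters_nat_def)
      then have "eventually (\<lambda>n. \<phi> n f = 0) F" by (rule eventually_mono) (simp add: f)
      then show ?thesis
        using tendsto_unique[OF nontriv[OF F] lim[OF F] tendsto_eventually] False by simp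
    qed
    then show ?thesis using f by blast
  qed
  have inj: "inj_on r ultrafilters_nat"
  proof (rule inj_onI)
    fix F G assume F: "F \<in> ultrafilters_nat" and G: "G \<in> ultrafilters_nat" and eq: "r F = r G"
    have "eventually P F \<longleftrightarrow> eventually P G" for P
    proof -
      obtain f c where c: "c > 0" and
          f: "\<And>F. F \<in> ultrafilters_nat \<Longrightarrow> r F f = (if eventually (\<lambda>n. n \<in> Collect P) F then c else 0)"
        using r_sep[of "Collect P"] by blast
      have "r F f = r G f" using eq by simp
      then show ?thesis using f[OF F] f[OF G] c by (simp split: if_splits)
    qed
    then show "F = G" by (simp add: filter_eq_iff)
  qed
  let ?S = "r ` ultrafilters_nat"
  have topW: "topspace ?W = dual_unit_ball ?C sup_norm"
    by (auto simp: weak_star_topology_def dual_unit_ball_def)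
  have S: "?S \<subseteq> topspace ?W" using r_dual topW by auto
  have cont: "continuous_map beta_omega (subtopology ?W ?S) r"
    using r_dual continuous_map_ultrafilter_limit[OF bounded]
    by (auto simp: weak_star_topology_def continuous_map_in_subtopology continuous_map_componentwise_UNIV
        r_def[abs_def] dual_unit_ball_def)
  let ?i = "inv_into ultrafilters_nat r"
  have inv: "?i (r F) = F" if "F \<in> ultrafilters_nat" for F using inj that by (rule inv_into_f_f)
  have "continuous_map (subtopology ?W ?S) beta_omega ?i"
    unfolding beta_omega_def
  proof (rule continuous_on_generated_topo)
    fix B assume "B \<in> range (\<lambda>A. {F \<in> ultrafilters_nat. eventually (\<lambda>n. n \<in> A) F})"
    then obtain A where B: "B = {F \<in> ultrafilters_nat. eventually (\<lambda>n. n \<in> A) F}" by blast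
    obtain f c where f: "c > 0" "\<And>F. F \<in> ultrafilters_nat \<Longrightarrow> r F f = (if eventually (\<lambda>n. n \<in> A) F then c else 0)"
      using r_sep[of A] by blast
    \<comment> \<open>\<open>r F f\<close> takes only the values \<open>c\<close> and 0, so the
      condition \<open>\<psi> f > 0\<close> picks out the image of the basic set
      \<open>B\<close>.\<close>
    have "?i -` B \<inter> topspace (subtopology ?W ?S) = {\<psi> \<in> topspace (subtopology ?W ?S). \<psi> f \<in> {0<..}}"
      using f inv by (auto simp: B split: if_splits)
    moreover have "continuous_map (subtopology ?W ?S) euclideanreal (\<lambda>\<psi>. \<psi> f)"
      unfolding weak_star_topology_def
      by (intro continuous_map_from_subtopology continuous_map_product_projection) simp
    ultimately show "openin (subtopology ?W ?S) (?i -` B \<inter> topspace (subtopology ?W ?S))"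
      by (simp only: openin_continuous_map_preimage open_greaterThan flip: open_openin)
  next
    show "?i ` topspace (subtopology ?W ?S) \<subseteq> \<Union> (range (\<lambda>A. {F \<in> ultrafilters_nat. eventually (\<lambda>n. n \<in> A) F}))"
      using inv by (auto intro!: exI[of _ UNIV])
  qed
  then have "homeomorphic_maps (subtopology ?W ?S) beta_omega ?i r"
    using cont inv by (auto simp: homeomorphic_maps_def)
  then show ?thesis
    unfolding contains_copy_of_def homeomorphic_space_def using S by blast
qed

lemma no_l_infinity_quotient:
  assumes X: "compact_space X" "Hausdorff_space X"
    and no_copy: "\<not> contains_copy_of
      (subtopology (weak_star_topology (continuous_functions X) sup_norm)
        (dual_unit_ball (continuous_functions X) sup_norm)) beta_omega"
  shows "\<not> has_quotient_isomorphic (pointwise_topology (continuous_functions X)) (pointwise_topology l_infinity)"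
proof
  let ?C = "continuous_functions X"
  let ?D = "dual_space ?C sup_norm" and ?d = "dual_norm ?C sup_norm"
  assume "has_quotient_isomorphic (pointwise_topology ?C) (pointwise_topology l_infinity)"
  then obtain q where q: "linear_quotient_map (pointwise_topology ?C) (pointwise_topology l_infinity) q"
    by (auto simp: has_quotient_isomorphic_def)
  then have im: "q ` ?C = l_infinity" by (simp add: linear_quotient_map_def)
  obtain a where a: "\<And>n. finite {x. a n x \<noteq> 0}" "\<And>n. {x. a n x \<noteq> 0} \<subseteq> topspace X"
    and q_eq: "\<And>n f. f \<in> ?C \<Longrightarrow> q f n = (\<Sum>x | a n x \<noteq> 0. a n x * f x)"
    using quotient_map_coordinates[OF X q] by blast
  define \<phi> where "\<phi> n f = (if f \<in> ?C then \<Sum>x | a n x \<noteq> 0. a n x * f x else 0)" for n f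
  have \<phi>D: "\<phi> n \<in> ?D" for n unfolding \<phi>_def by (rule finite_support_dual_space[OF X(1)])
  have \<phi>q: "\<phi> n f = q f n" if "f \<in> ?C" for n f using that by (simp add: \<phi>_def q_eq)
  have "bounded (range (\<lambda>n. \<phi> n f))" if "f \<in> ?C" for f
    using that im by (auto simp: \<phi>q l_infinity_def)
  then obtain M where M: "\<And>n. ?d (\<phi> n) \<le> M"
    using banach_steinhaus_continuous_functions[of X \<phi>, OF X(1) \<phi>D] by blast
  \<comment> \<open>The form \<open>\<bar>M\<bar> + 1\<close> keeps the divisor positive whatever
    the sign of \<open>M\<close>.\<close>
  define b where "b = 1 / (\<bar>M\<bar> + 1)"
  have b: "b > 0" by (simp add: b_def)
  let ?\<psi> = "\<lambda>n f. b * \<phi> n f"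
  have "contains_copy_of
      (subtopology (weak_star_topology ?C sup_norm) (dual_unit_ball ?C sup_norm)) beta_omega"
  proof (rule beta_omega_in_dual_unit_ball[OF X(1), of ?\<psi>])
    show "?\<psi> n \<in> ?D" for n by (rule dual_space_scale[OF \<phi>D])
    show "?d (?\<psi> n) \<le> 1" for n
    proof (rule dual_norm_sup_norm_le[OF X(1)])
      fix f assume f: "f \<in> ?C" "\<And>x. \<bar>f x\<bar> \<le> 1"
      have "\<bar>\<phi> n f\<bar> \<le> \<bar>M\<bar> + 1"
        using abs_le_dual_norm_sup_norm[OF X(1) \<phi>D f, of n] M[of n] by linarith
      then show "\<bar>?\<psi> n f\<bar> \<le> 1" by (simp add: b_def abs_mult)
    qed
    show "\<exists>f\<in>?C. \<exists>c>0. \<forall>n. ?\<psi> n f = (if n \<in> A then c else 0)" for A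
    proof -
      \<comment> \<open>A preimage of the indicator of \<open>A\<close> under \<open>q\<close>
        separates, with the scaling factor \<open>b\<close> as the value on
        \<open>A\<close>.\<close>
      have "(\<lambda>n. if n \<in> A then 1 else 0) \<in> l_infinity"
        by (auto simp: l_infinity_def bounded_real intro!: exI[of _ 1])
      then obtain f where f: "f \<in> ?C" "q f = (\<lambda>n. if n \<in> A then 1 else 0)" using im by (metis imageE)
      then show ?thesis using b by (intro bexI[of _ f] exI[of _ b]) (auto simp: \<phi>q)
    qed
  qed
  then show False using no_copy by blast
qed

section \<open>Compactness of Talagrand's space\<close>

abbreviation cube :: "'i set \<Rightarrow> ('i \<Rightarrow> bool) topology" where
  "cube A \<equiv> product_topology (\<lambda>_. discrete_topology UNIV) A"

lemma compact_space_cube: "compact_space (cube A)"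
  by (simp add: compact_space_product_topology compact_space_discrete_topology)

lemma Hausdorff_space_cube: "Hausdorff_space (cube A)"
  by (simp add: Hausdorff_space_product_topology)

lemma continuous_map_cube_restrict:
  "A \<subseteq> B \<Longrightarrow> continuous_map (cube B) (cube A) (\<lambda>t. restrict t A)"
  by (auto simp: continuous_map_componentwise intro!: continuous_map_product_projection)

lemma continuous_map_cube_update:
  "continuous_map (cube A) (cube (insert i A)) (\<lambda>t. t(i := b))"
  unfolding continuous_map_componentwise
proof (intro conjI ballI)
  show "(\<lambda>t. t(i := b)) ` topspace (cube A) \<subseteq> extensional (insert i A)"
    by (auto simp: PiE_iff extensional_def)
  show "continuous_map (cube A) (discrete_topology UNIV) (\<lambda>t. (t(i := b)) k)" if "k \<in> insert i A" for k
    using that by (cases "k = i") (auto intro: continuous_map_product_projection)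
qed

text \<open>Serves both the limit stages and the final space. The set is an intersection of closed
  preimages; with \<open>M\<close> nonempty this intersection lies inside the cube.\<close>

lemma closedin_cube_inverse_limit:
  assumes "M \<noteq> {}" "\<And>\<alpha>. \<alpha> \<in> M \<Longrightarrow> closedin (cube {..<\<alpha>}) (K \<alpha>)" "\<And>\<alpha>. \<alpha> \<in> M \<Longrightarrow> {..<\<alpha>} \<subseteq> B"
  shows "closedin (cube B) {t \<in> B \<rightarrow>\<^sub>E UNIV. \<forall>\<alpha>\<in>M. proj \<alpha> t \<in> K \<alpha>}"
proof -
  have "closedin (cube B) (\<Inter>\<alpha>\<in>M. {t \<in> topspace (cube B). proj \<alpha> t \<in> K \<alpha>})"
    using assms
    by (intro closedin_INT closedin_continuous_map_preimage[OF continuous_map_cube_restrict]) auto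
  moreover have "(\<Inter>\<alpha>\<in>M. {t \<in> topspace (cube B). proj \<alpha> t \<in> K \<alpha>}) =
      {t \<in> B \<rightarrow>\<^sub>E UNIV. \<forall>\<alpha>\<in>M. proj \<alpha> t \<in> K \<alpha>}"
    using assms(1) by auto
  ultimately show ?thesis by simp
qed

section \<open>Successor ordinals and closedness of the stages\<close>

text \<open>A largest element together with its countably many predecessors would exhaust
  \<open>omega1\<close>. Hence the \<open>LEAST\<close> in \<open>osuc\<close> ranges over a
  nonempty set.\<close>

lemma less_osuc: "\<alpha> < osuc \<alpha>"
proof -
  have "\<exists>b. \<alpha> < b"
  proof (rule ccontr)
    assume "\<not> ?thesis"
    then have "UNIV = insert \<alpha> {..<\<alpha>}" by (auto simp: not_less intro: order_neq_le_trans)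
    then show False
      using uncountable_omega1 countable_lessThan_omega1[of \<alpha>] by (metis countable_insert)
  qed
  then show ?thesis unfolding osuc_def by (rule LeastI_ex)
qed

lemma lessThan_osuc: "{..<osuc \<alpha>} = insert \<alpha> {..<\<alpha>}"
proof -
  have "b < osuc \<alpha> \<longleftrightarrow> b \<le> \<alpha>" for b
    using less_osuc[of \<alpha>] not_less_Least[of b "\<lambda>b. \<alpha> < b"] unfolding osuc_def[symmetric]
    by (meson not_less le_less_trans)
  then show ?thesis by (auto simp: le_less)
qed

text \<open>Induction along the construction. At successors \<open>Y \<alpha>\<close> and
  \<open>Z \<alpha>\<close> are closed in the cube by the induction hypothesis, hence compact; their
  images under the coordinate update are compact in a Hausdorff cube and so closed.\<close>

lemma (in talagrand_realisation) closedin_cube_K: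
  assumes "omega \<le> \<alpha>"
  shows "closedin (cube {..<\<alpha>}) (K \<alpha>)"
  using assms
proof (induction \<alpha> rule: less_induct)
  case (less \<rho>)
  consider "\<rho> = omega" | \<alpha> where "\<rho> = osuc \<alpha>" "omega < \<rho>" | "omega < \<rho>" "\<forall>\<alpha>. \<rho> \<noteq> osuc \<alpha>"
    using less.prems by (auto simp: le_less)
  then show ?case
  proof cases
    case 1
    then show ?thesis using closedin_topspace[of "cube {..<omega}"] by (simp add: K_omega)
  next
    case 2
    then have \<alpha>: "omega \<le> \<alpha>" using lessThan_osuc[of \<alpha>] by (auto simp: set_eq_iff le_less)
    have K\<alpha>: "closedin (cube {..<\<alpha>}) (K \<alpha>)" using less.IH \<alpha> less_osuc 2(1) by blast
    have "closedin (cube {..<\<rho>}) ((\<lambda>t. t(\<alpha> := b)) ` S)" if "closedin (stage K \<alpha>) S" for S b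
    proof -
      have "closedin (cube {..<\<alpha>}) S"
        using closedin_trans_full[OF _ K\<alpha>] that by (simp add: cube_subspace_def)
      then have "compactin (cube {..<\<alpha>}) S" by (rule closedin_compact_space[OF compact_space_cube])
      then have "compactin (cube {..<\<rho>}) ((\<lambda>t. t(\<alpha> := b)) ` S)"
        using continuous_map_cube_update[of "{..<\<alpha>}" \<alpha> b] unfolding 2(1) lessThan_osuc
        by (rule image_compactin)
      then show ?thesis by (rule compactin_imp_closedin[OF Hausdorff_space_cube])
    qed
    then show ?thesis
      using Y_Z_closed[OF \<alpha>] by (simp add: 2(1) K_osuc[OF \<alpha>] closedin_Un)
  next
    case 3
    have "closedin (cube {..<\<rho>}) {t \<in> {..<\<rho>} \<rightarrow>\<^sub>E UNIV. \<forall>\<alpha>\<in>{omega..<\<rho>}. proj \<alpha> t \<in> K \<alpha>}"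
      using 3(1) less.IH by (intro closedin_cube_inverse_limit) auto
    then show ?thesis by (simp add: K_limit[OF 3] Ball_def)
  qed
qed

lemma talagrand_compactum_compact_Hausdorff:
  assumes "talagrand_compactum X"
  shows "compact_space X" "Hausdorff_space X"
proof -
  obtain K Y Z \<eta> U \<nu> I J N\<^sub>0 N\<^sub>1 where "talagrand_realisation K Y Z \<eta> U \<nu> I J N\<^sub>0 N\<^sub>1"
    and X: "X = cube_subspace UNIV {t. \<forall>\<alpha>. omega \<le> \<alpha> \<longrightarrow> proj \<alpha> t \<in> K \<alpha>}"
    using assms unfolding talagrand_compactum_def by blast
  then interpret talagrand_realisation K Y Z \<eta> U \<nu> I J N\<^sub>0 N\<^sub>1 by blast
  have "closedin (cube UNIV) {t \<in> UNIV \<rightarrow>\<^sub>E UNIV. \<forall>\<alpha>\<in>{omega..}. proj \<alpha> t \<in> K \<alpha>}"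
    by (intro closedin_cube_inverse_limit closedin_cube_K) auto
  then have "closedin (cube UNIV) {t. \<forall>\<alpha>. omega \<le> \<alpha> \<longrightarrow> proj \<alpha> t \<in> K \<alpha>}"
    by (simp add: Ball_def)
  then show "compact_space X"
    unfolding X cube_subspace_def
    by (intro compact_space_subtopology closedin_compact_space[OF compact_space_cube])
  show "Hausdorff_space X"
    unfolding X cube_subspace_def by (intro Hausdorff_space_subtopology Hausdorff_space_cube)
qed

theorem corollary1p4:
  fixes X :: "(omega1 \<Rightarrow> bool) topology"
  assumes "talagrand_compactum X"
    and "grothendieck_property (continuous_functions X) sup_norm"
    and "\<not> contains_copy_of
           (subtopology (weak_star_topology (continuous_functions X) sup_norm)
              (dual_unit_ball (continuous_functions X) sup_norm))
           beta_omega"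
  shows "\<not> has_quotient_isomorphic (pointwise_topology (continuous_functions X)) (pointwise_topology c_zero) \<and>
         \<not> has_quotient_isomorphic (pointwise_topology (continuous_functions X)) (pointwise_topology l_infinity) \<and>
         (\<forall>p\<ge>1. \<not> has_quotient_isomorphic (pointwise_topology (continuous_functions X)) (pointwise_topology (l_space p)))"
proof -
  note X = talagrand_compactum_compact_Hausdorff[OF assms(1)]
  note no_quotient = grothendieck_no_null_sequence_quotient[OF X assms(2)]
  \<comment> \<open>For \<open>c_zero\<close> the witness is borrowed from
    \<open>l_space 1\<close>.\<close>
  have "\<exists>y\<in>c_zero. \<forall>k. y (s k) = (1/2) ^ k" if "strict_mono s" for s
    using l_space_geometric_subsequence[OF order_refl that] l_space_subset_c_zero[OF order_refl]
    by blast
  then have "\<not> has_quotient_isomorphic (pointwise_topology (continuous_functions X)) (pointwise_topology c_zero)"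
    by (intro no_quotient) auto
  moreover have "\<not> has_quotient_isomorphic (pointwise_topology (continuous_functions X)) (pointwise_topology (l_space p))"
    if "p \<ge> 1" for p
    using that by (intro no_quotient l_space_subset_c_zero l_space_geometric_subsequence)
  ultimately show ?thesis using no_l_infinity_quotient[OF X assms(3)] by blast
qed

end
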